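(* Let $T$ be an $\mathbf{r}$-rooted spanning tree of $(K_{[n]})_{\mathbf{r}}\cong K_{[n]\sqcup\{\mathbf{r}\}}$ and let $C=\{\pi_0\lessdot\pi_1\lessdot\cdots\lessdot\pi_n\}$ be a maximal chain of $NC([0,n])$. Then $T_{(C_T)}=T$ and $C_{(T_C)}=C$. Hence $T\mapsto C_T$ and $C\mapsto T_C$ are mutually inverse bijections between $\mathbf{r}$-rooted spanning trees of $(K_{[n]})_{\mathbf{r}}$ (equivalently rooted spanning forests of $K_{[n]}$) and maximal chains of $NC([0,n])$.
   Context: $NC([0,n])$ is the lattice, ordered by refinement, of non-crossing partitions of $\{0,1,\dots,n\}$: set partitions with no $i<j<k<l$ and distinct blocks $B\ni i,k$, $B'\ni j,l$. $K_{[n]}$ is the complete graph, and $(K_{[n]})_{\mathbf{r}}$ adds a vertex $\mathbf{r}$ adjacent to all others; rooted trees have edges directed towards $\mathbf{r}$, $(i,i_{\mathbf{r}})$ being the unique edge out of $i\in[n]$. $T_C$: for a maximal chain $C$ and $i\in[n]$, let $\bar i$ be the unique element that is minimal in its block of $\pi_{i-1}$ but not in its block of $\pi_i$, and $\underline{i}$ the element of the block of $\bar i$ in $\pi_i$ immediately preceding $\bar i$. Let $p_C(\mathbf{r})=0$, $p_C(i)=\bar i$, and $E(T_C)=\{(p_C^{-1}(\bar i),p_C^{-1}(\underline{i})):i\in[n]\}$ (these are well defined and $T_C$ is an $\mathbf{r}$-rooted spanning tree). $C_T$: for an $\mathbf{r}$-rooted spanning tree $T$, let $p$ be the unique bijection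 $[n]\sqcup\{\mathbf{r}\}\to\{0,\dots,n\}$ such that $(u,v)\in E(T)\Rightarrow p(v)<p(u)$; for edges $(i,k),(j,k)$ with $i<j$, $p(i)>p(j)$; and no two edges $(u,v),(u',v')$ satisfy $p(v)<p(v')<p(u)<p(u')$. Let $\pi_0$ be the partition of $[0,n]$ into singletons and, for $i\in[n]$, $\pi_i$ be obtained from $\pi_{i-1}$ by merging the block containing $p(i)$ with the block containing $p(i_{\mathbf{r}})$; $C_T=\{\pi_0,\dots,\pi_n\}$ (this is known to be a maximal chain of $NC([0,n])$). *)

theory Defs
  imports Main "HOL-Library.Disjoint_Sets" "HOL-Library.FuncSet" "HOL-Library.Ramsey"
begin

section \<open>Maximal chains of non-crossing partitions\<close>

definition noncrossing :: "nat set set \<Rightarrow> bool" where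
  "noncrossing P \<longleftrightarrow>
     \<not> (\<exists>i j k l. \<exists>B\<in>P. \<exists>B'\<in>P. i < j \<and> j < k \<and> k < l \<and> B \<noteq> B' \<and>
          i \<in> B \<and> k \<in> B \<and> j \<in> B' \<and> l \<in> B')"

definition NC :: "nat \<Rightarrow> nat set set set" where
  "NC n = {P. partition_on {0..n} P \<and> noncrossing P}"

definition max_chains :: "nat \<Rightarrow> nat set set set set" where
  "max_chains n = {C. pred_on.maxchain (NC n) (refines {0..n}) C}"

text \<open>A maximal chain is the set of its members; the member \<open>\<pi>\<^sub>i\<close> of
  \<open>\<pi>\<^sub>0 \<lessdot> \<dots> \<lessdot> \<pi>\<^sub>n\<close> is recovered as the one having exactly \<open>i\<close> strictly smaller members.\<close>

definition chain_elem :: "nat \<Rightarrow> nat set set set \<Rightarrow> nat \<Rightarrow> nat set set" where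
  "chain_elem n C i = (THE P. P \<in> C \<and> card {Q \<in> C. refines {0..n} Q P \<and> Q \<noteq> P} = i)"

definition block_of :: "'a set set \<Rightarrow> 'a \<Rightarrow> 'a set" where
  "block_of P x = (THE B. B \<in> P \<and> x \<in> B)"

definition merge_blocks :: "'a set set \<Rightarrow> 'a \<Rightarrow> 'a \<Rightarrow> 'a set set" where
  "merge_blocks P x y =
     insert (block_of P x \<union> block_of P y) (P - {block_of P x, block_of P y})"

section \<open>Graphs, rooted spanning trees and rooted spanning forests\<close>

type_synonym 'a graph = "'a set \<times> 'a set set"

definition complete_graph :: "'a set \<Rightarrow> 'a graph" where
  "complete_graph V = (V, nsets V 2)"

text \<open>The new vertex \<open>\<^bold>r\<close> of \<open>G\<^sub>\<^bold>r\<close> is \<^const>\<open>None\<close>; an old vertex \<open>v\<close> becomes \<open>Some v\<close>.\<close>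

definition cone :: "'a graph \<Rightarrow> 'a option graph" where
  "cone G = (insert None (Some ` fst G),
             (\<lambda>e. Some ` e) ` snd G \<union> {{Some v, None} | v. v \<in> fst G})"

definition adj :: "'a set set \<Rightarrow> ('a \<times> 'a) set" where
  "adj F = {(u, v). {u, v} \<in> F}"

definition is_cycle :: "'a set set \<Rightarrow> 'a list \<Rightarrow> bool" where
  "is_cycle F xs \<longleftrightarrow> length xs \<ge> 3 \<and> distinct xs \<and>
     (\<forall>i < length xs. {xs ! i, xs ! (Suc i mod length xs)} \<in> F)"

text \<open>Spanning forests and spanning trees of \<open>G\<close> have the vertex set of \<open>G\<close>
  and are given by their edge sets.\<close>

definition spanning_forest :: "'a graph \<Rightarrow> 'a set set \<Rightarrow> bool" where
  "spanning_forest G F \<longleftrightarrow> F \<subseteq> snd G \<and> \<not> (\<exists>xs. is_cycle F xs)"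

definition spanning_tree :: "'a graph \<Rightarrow> 'a set set \<Rightarrow> bool" where
  "spanning_tree G F \<longleftrightarrow>
     spanning_forest G F \<and> (\<forall>u \<in> fst G. \<forall>v \<in> fst G. (u, v) \<in> (adj F)\<^sup>*)"

definition underlying :: "('a \<times> 'a) set \<Rightarrow> 'a set set" where
  "underlying T = {{u, v} | u v. (u, v) \<in> T}"

text \<open>A rooted spanning tree is given by its set of directed edges: every edge of a spanning
  tree is given exactly one direction, in such a way that the directed edges lead to the root.\<close>

definition rooted_spanning_trees :: "'a graph \<Rightarrow> 'a \<Rightarrow> ('a \<times> 'a) set set" where
  "rooted_spanning_trees G r =
     {T. spanning_tree G (underlying T) \<and>
         (\<forall>u v. (u, v) \<in> T \<longrightarrow> (v, u) \<notin> T) \<and>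
         (\<forall>u v. (u, v) \<in> T \<longrightarrow> (v, r) \<in> T\<^sup>*)}"

text \<open>A rooted spanning forest is a spanning forest together with a set of roots
  containing exactly one vertex of each connected component.\<close>

definition rooted_spanning_forests :: "'a graph \<Rightarrow> ('a set set \<times> 'a set) set" where
  "rooted_spanning_forests G =
     {(F, R). spanning_forest G F \<and> R \<subseteq> fst G \<and>
              (\<forall>v \<in> fst G. \<exists>!r. r \<in> R \<and> (v, r) \<in> (adj F)\<^sup>*)}"

definition delete_root :: "('a option \<times> 'a option) set \<Rightarrow> 'a set set \<times> 'a set" where
  "delete_root T = ({{i, j} | i j. (Some i, Some j) \<in> T}, {i. (Some i, None) \<in> T})"

abbreviation cone_vertices :: "nat \<Rightarrow> nat option set" where
  "cone_vertices n \<equiv> insert None (Some ` {1..n})"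

abbreviation root_trees :: "nat \<Rightarrow> (nat option \<times> nat option) set set" where
  "root_trees n \<equiv> rooted_spanning_trees (cone (complete_graph {1..n})) None"

section \<open>The tree \<open>T\<^sub>C\<close> of a maximal chain \<open>C\<close>\<close>

definition upper :: "nat \<Rightarrow> nat set set set \<Rightarrow> nat \<Rightarrow> nat" where
  "upper n C i = (THE x. x \<in> {0..n} \<and>
     x = Min (block_of (chain_elem n C (i - 1)) x) \<and>
     x \<noteq> Min (block_of (chain_elem n C i) x))"

definition lower :: "nat \<Rightarrow> nat set set set \<Rightarrow> nat \<Rightarrow> nat" where
  "lower n C i = Max {y \<in> block_of (chain_elem n C i) (upper n C i). y < upper n C i}"

definition chain_label :: "nat \<Rightarrow> nat set set set \<Rightarrow> nat option \<Rightarrow> nat" where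
  "chain_label n C v = (case v of None \<Rightarrow> 0 | Some i \<Rightarrow> upper n C i)"

definition tree_of_chain :: "nat \<Rightarrow> nat set set set \<Rightarrow> (nat option \<times> nat option) set" where
  "tree_of_chain n C =
     (\<lambda>i. (inv_into (cone_vertices n) (chain_label n C) (upper n C i),
           inv_into (cone_vertices n) (chain_label n C) (lower n C i))) ` {1..n}"

section \<open>The maximal chain \<open>C\<^sub>T\<close> of a rooted spanning tree \<open>T\<close>\<close>

text \<open>Extensionality only makes the labelling unique as a total function.\<close>

definition is_tree_label ::
    "nat \<Rightarrow> (nat option \<times> nat option) set \<Rightarrow> (nat option \<Rightarrow> nat) \<Rightarrow> bool" where
  "is_tree_label n T p \<longleftrightarrow>
     p \<in> extensional (cone_vertices n) \<and>
     bij_betw p (cone_vertices n) {0..n} \<and>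
     (\<forall>u v. (u, v) \<in> T \<longrightarrow> p v < p u) \<and>
     (\<forall>i j k. (Some i, k) \<in> T \<and> (Some j, k) \<in> T \<and> i < j \<longrightarrow> p (Some i) > p (Some j)) \<and>
     \<not> (\<exists>u v u' v'. (u, v) \<in> T \<and> (u', v') \<in> T \<and> p v < p v' \<and> p v' < p u \<and> p u < p u')"

definition tree_label :: "nat \<Rightarrow> (nat option \<times> nat option) set \<Rightarrow> nat option \<Rightarrow> nat" where
  "tree_label n T = (THE p. is_tree_label n T p)"

definition parent :: "('a option \<times> 'a option) set \<Rightarrow> 'a \<Rightarrow> 'a option" where
  "parent T i = (THE v. (Some i, v) \<in> T)"

primrec tree_partition ::
    "nat \<Rightarrow> (nat option \<times> nat option) set \<Rightarrow> nat \<Rightarrow> nat set set" where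
  "tree_partition n T 0 = (\<lambda>x. {x}) ` {0..n}"
| "tree_partition n T (Suc i) =
     merge_blocks (tree_partition n T i)
       (tree_label n T (Some (Suc i))) (tree_label n T (parent T (Suc i)))"

definition chain_of_tree :: "nat \<Rightarrow> (nat option \<times> nat option) set \<Rightarrow> nat set set set" where
  "chain_of_tree n T = tree_partition n T ` {0..n}"

end

theory Submission
  imports Defs
begin

text \<open>
  A tree labelling lists the vertices of \<open>T\<close> in depth-first preorder, so it exists and is unique.
  It turns the edges of \<open>T\<close> into noncrossing arcs \<open>l i < x i\<close> on the line \<open>{0..n}\<close>, where \<open>x i\<close> is
  the label of vertex \<open>i\<close> and \<open>l i\<close> that of its parent. Merging along the arcs in the order
  \<open>i = 1, \<dots>, n\<close> produces noncrossing partitions, because an arc leaving a block over an element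
  of another block would have to cross an arc of that block. At step \<open>i\<close> the label \<open>x i\<close> stops being
  a block minimum, and the sibling condition makes \<open>l i\<close> its predecessor in the merged block; so
  the arcs, and with them \<open>T\<close>, are read off from the chain. Conversely, every cover relation of the
  noncrossing partition lattice merges two blocks, and the pairs \<open>(l i, x i)\<close> read off from a maximal
  chain satisfy the conditions on arcs: a violation would put an element of a block strictly between
  \<open>x i\<close> and its predecessor.
\<close>

section \<open>Rooted spanning trees as parent functions\<close>

text \<open>The obstacle is that trees, chains and labels are given by global conditions or by
  definite descriptions, none of which can be computed with. Cycle-freeness and connectivity are
  traded for a parent relation (\<open>functional_tree\<close>); what links the two views is that an
  edge of a cycle-free graph is the only connection between its ends. The same fact settles the
  forests: \<open>delete_root\<close> forgets directions, but each edge can point only to the side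
  that contains the root. A maximal chain is an unindexed set, maximal under inclusion; it becomes a
  sequence with one member for each number of blocks (\<open>saturated\<close>), since between any
  two comparable noncrossing partitions a single merge of two blocks fits. Both directions of the
  bijection then meet in one axiom system, \<open>noncrossing_arcs\<close>: a labelled tree and a
  saturated chain each yield it, and \<open>arc_partition\<close> serves for both. The predicate
  \<open>merge_step\<close> carries the data that makes the descriptions in \<open>upper\<close> and
  \<open>lower\<close> evaluate.\<close>

lemma sym_adj: "sym (adj F)"
  by (auto simp: adj_def sym_def insert_commute)

lemma adj_rtrancl_sym: "(u, v) \<in> (adj F)\<^sup>* \<Longrightarrow> (v, u) \<in> (adj F)\<^sup>*"
  using sym_rtrancl[OF sym_adj] by (rule symD)

lemma adj_rtrancl_mono: "(u, v) \<in> (adj F)\<^sup>* \<Longrightarrow> F \<subseteq> G \<Longrightarrow> (u, v) \<in> (adj G)\<^sup>*"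
  by (rule rtrancl_mono[THEN subsetD]) (auto simp: adj_def)

text \<open>A walk of least length repeats no value: the stretch between two equal values could be
  cut out. Distinctness is what lets such a walk close up to a cycle.\<close>

lemma shortest_walk_inj:
  assumes "(u, v) \<in> R\<^sup>*"
  obtains f k where "f 0 = u" "f k = v" "\<And>i. i < k \<Longrightarrow> (f i, f (Suc i)) \<in> R" "inj_on f {..k::nat}"
proof -
  define k where "k = (LEAST k. (u, v) \<in> R ^^ k)"
  have ex: "\<exists>k. (u, v) \<in> R ^^ k"
    using assms by (simp add: rtrancl_power)
  have least: "k \<le> m" if "(u, v) \<in> R ^^ m" for m
    unfolding k_def using that by (rule Least_le)
  have "(u, v) \<in> R ^^ k"
    unfolding k_def using ex by (rule LeastI_ex)
  then obtain f where f: "f 0 = u" "f k = v" "\<forall>i<k. (f i, f (Suc i)) \<in> R"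
    unfolding relpow_fun_conv by blast
  have "f i \<noteq> f j" if "i < j" "j \<le> k" for i j
  proof
    assume eq: "f i = f j"
    have "(u, f i) \<in> R ^^ i"
      unfolding relpow_fun_conv using f that by (intro exI[of _ f]) auto
    moreover have "(f j, v) \<in> R ^^ (k - j)"
      unfolding relpow_fun_conv using f that by (intro exI[of _ "\<lambda>a. f (a + j)"]) auto
    ultimately have "(u, v) \<in> R ^^ (i + (k - j))"
      unfolding relpow_add using eq by auto
    from least[OF this] that show False by simp
  qed
  then have "inj_on f {..k}"
    by (metis atMost_iff inj_onI linorder_neqE_nat)
  with f show thesis by (intro that) auto
qed

text \<open>A walk between the ends that avoids the edge, taken without repetitions, would form a
  cycle together with the edge.\<close>

lemma acyclic_edge_is_bridge:
  assumes acyclic: "\<not> (\<exists>xs. is_cycle F xs)" and e: "{u, v} \<in> F" "u \<noteq> v"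
  shows "(u, v) \<notin> (adj (F - {{u, v}}))\<^sup>*"
proof
  assume "(u, v) \<in> (adj (F - {{u, v}}))\<^sup>*"
  then obtain f k where f: "f 0 = u" "f k = v"
    "\<And>i. i < k \<Longrightarrow> (f i, f (Suc i)) \<in> adj (F - {{u, v}})" "inj_on f {..k::nat}"
    using shortest_walk_inj by metis
  \<comment> \<open>Length 0 would make the ends equal and length 1 would use the deleted edge, so
    the closed walk has at least the three vertices that \<open>is_cycle\<close> demands.\<close>
  have "k \<noteq> 0" using f e by (cases k) auto
  moreover have "k \<noteq> 1" using f(1,2) f(3)[of 0] by (auto simp: adj_def)
  ultimately have k: "k \<ge> 2" by simp
  define xs where "xs = map f [0..<Suc k]"
  have len: "length xs = Suc k" by (simp add: xs_def)
  have "distinct xs"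
    unfolding xs_def using f(4) by (auto simp: distinct_map inj_on_def simp del: upt_Suc)
  moreover have "{xs ! i, xs ! (Suc i mod length xs)} \<in> F" if "i < length xs" for i
  proof (cases "i = k")
    case True
    have "xs ! i = v" "xs ! (Suc i mod length xs) = u"
      using True f len by (auto simp: xs_def simp del: upt_Suc)
    then show ?thesis using e by (simp add: insert_commute)
  next
    case False
    then have "i < k" using that len by simp
    then have "xs ! i = f i" "xs ! (Suc i mod length xs) = f (Suc i)"
      using len by (auto simp: xs_def simp del: upt_Suc)
    then show ?thesis using f(3)[OF \<open>i < k\<close>] by (simp add: adj_def)
  qed
  ultimately have "is_cycle F xs"
    using k len by (simp add: is_cycle_def)
  then show False using acyclic by blast
qed

text \<open>Follow the walk until it would use the deleted edge: at that moment it stands at one of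
  the two ends.\<close>

lemma rtrancl_delete_edge:
  assumes "(x, r) \<in> (adj F)\<^sup>*"
  shows "(x, r) \<in> (adj (F - {{u, v}}))\<^sup>* \<or> (x, u) \<in> (adj (F - {{u, v}}))\<^sup>* \<or> (x, v) \<in> (adj (F - {{u, v}}))\<^sup>*"
  using assms
proof (induction rule: rtrancl_induct)
  case (step y z)
  show ?case
  proof (cases "{y, z} = {u, v}")
    case True
    then show ?thesis using step.IH by (auto simp: doubleton_eq_iff)
  next
    case False
    then have "(y, z) \<in> adj (F - {{u, v}})"
      using step.hyps by (auto simp: adj_def)
    then show ?thesis using step.IH by (auto intro: rtrancl_into_rtrancl)
  qed
qed simp

text \<open>Replaces cycles and undirected connectivity by directed data alone: \<open>T\<close> is
  the graph of a parent function. On complete graphs this agrees with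
  \<open>rooted_spanning_trees\<close>, and nearly all later arguments use this form.\<close>

definition functional_tree :: "'a set \<Rightarrow> 'a \<Rightarrow> ('a \<times> 'a) set \<Rightarrow> bool" where
  "functional_tree V r T \<longleftrightarrow>
     T \<subseteq> (V - {r}) \<times> V \<and> single_valued T \<and> (\<forall>v\<in>V. (v, r) \<in> T\<^sup>*)"

lemma functional_treeD:
  assumes "functional_tree V r T"
  shows "(u, v) \<in> T \<Longrightarrow> u \<in> V" "(u, v) \<in> T \<Longrightarrow> u \<noteq> r" "(u, v) \<in> T \<Longrightarrow> v \<in> V"
    "(u, v) \<in> T \<Longrightarrow> (u, w) \<in> T \<Longrightarrow> v = w" "v \<in> V \<Longrightarrow> (v, r) \<in> T\<^sup>*"
  using assms by (auto simp: functional_tree_def single_valued_def)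

text \<open>The depth is the distance to the root. The way to the root is forced, so the distance
  grows by exactly one along each edge; it is the measure for extremal and inductive arguments on
  trees.\<close>

lemma functional_tree_depth:
  assumes T: "functional_tree V r T"
  obtains d :: "'a \<Rightarrow> nat" where "\<And>u v. (u, v) \<in> T \<Longrightarrow> d u = Suc (d v)"
proof
  define d where "d v = (LEAST k. (v, r) \<in> T ^^ k)" for v
  fix u v
  assume uv: "(u, v) \<in> T"
  have "\<exists>k. (v, r) \<in> T ^^ k"
    using functional_treeD(3,5)[OF T] uv by (meson rtrancl_power)
  then have dv: "(v, r) \<in> T ^^ d v"
    unfolding d_def by (rule LeastI_ex)
  show "d u = Suc (d v)"
    unfolding d_def[of u]
  proof (rule Least_equality)
    show "(u, r) \<in> T ^^ Suc (d v)"
      using uv dv by (rule relpow_Suc_I2)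
  next
    fix k
    assume k: "(u, r) \<in> T ^^ k"
    show "Suc (d v) \<le> k"
    proof (cases k)
      case 0
      then show ?thesis using k functional_treeD(2)[OF T uv] by simp
    next
      case (Suc m)
      then obtain w where "(u, w) \<in> T" "(w, r) \<in> T ^^ m"
        using k by (metis relpow_Suc_D2)
      then have "(v, r) \<in> T ^^ m"
        using functional_treeD(4)[OF T uv] by simp
      then show ?thesis unfolding Suc d_def by (simp add: Least_le)
    qed
  qed
qed

lemma underlying_memD: "{u, v} \<in> underlying T \<Longrightarrow> (u, v) \<in> T \<or> (v, u) \<in> T"
  by (auto simp: underlying_def doubleton_eq_iff)

lemma underlying_memI: "(u, v) \<in> T \<Longrightarrow> {u, v} \<in> underlying T"
  by (auto simp: underlying_def)

lemma functional_tree_acyclic: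
  assumes T: "functional_tree V r T"
  shows "\<not> is_cycle (underlying T) xs"
proof
  assume cyc: "is_cycle (underlying T) xs"
  define l where "l = length xs"
  have l: "l \<ge> 3" and dist: "distinct xs"
    and edge: "\<And>i. i < l \<Longrightarrow> {xs ! i, xs ! (Suc i mod l)} \<in> underlying T"
    using cyc by (auto simp: is_cycle_def l_def)
  obtain d :: "'a \<Rightarrow> nat" where d: "\<And>u v. (u, v) \<in> T \<Longrightarrow> d u = Suc (d v)"
    using functional_tree_depth[OF T] by blast
  \<comment> \<open>A deepest vertex of the cycle would have two distinct parents.\<close>
  have "\<exists>i<l. \<forall>j<l. d (xs ! j) \<le> d (xs ! i)"
    using obtains_MAX[of "{..<l}" "\<lambda>i. d (xs ! i)"] l
    by (metis Max_ge finite_imageI finite_lessThan imageI lessThan_iff lessThan_empty_iff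
        not_numeral_le_zero)
  then obtain i where i: "i < l" and mx: "\<And>j. j < l \<Longrightarrow> d (xs ! j) \<le> d (xs ! i)"
    by blast
  \<comment> \<open>The two neighbours of position \<open>i\<close> on the cycle, successor and
    predecessor; they differ because a cycle has length at least 3.\<close>
  define a where "a = Suc i mod l"
  define b where "b = (if i = 0 then l - 1 else i - 1)"
  have ab: "a < l" "b < l" "Suc b mod l = i"
    using l i by (auto simp: a_def b_def)
  have "a \<noteq> b"
    using l i by (cases "Suc i = l") (auto simp: a_def b_def)
  have "(xs ! i, xs ! a) \<in> T"
    using underlying_memD[OF edge[OF i]] d mx[OF ab(1)] by (fastforce simp: a_def)
  moreover have "(xs ! i, xs ! b) \<in> T"
    using underlying_memD[OF edge[OF ab(2)]] d mx[OF ab(2)] by (fastforce simp: ab(3))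
  ultimately have "xs ! a = xs ! b"
    by (rule functional_treeD(4)[OF T])
  then show False
    using dist ab \<open>a \<noteq> b\<close> by (simp add: l_def nth_eq_iff_index_eq)
qed

lemma rtrancl_subset_adj: "T\<^sup>* \<subseteq> (adj (underlying T))\<^sup>*"
  by (rule rtrancl_mono) (auto simp: adj_def underlying_memI)

lemma functional_tree_imp_rooted_spanning_tree:
  assumes T: "functional_tree V r T"
  shows "T \<in> rooted_spanning_trees (complete_graph V) r"
proof -
  obtain d :: "'a \<Rightarrow> nat" where d: "\<And>u v. (u, v) \<in> T \<Longrightarrow> d u = Suc (d v)"
    using functional_tree_depth[OF T] by blast
  have asym: "(v, u) \<notin> T" if "(u, v) \<in> T" for u v
    using d[OF that] d[of v u] by force
  have "underlying T \<subseteq> nsets V 2"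
    using functional_treeD[OF T] asym by (fastforce simp: underlying_def)
  moreover have "(u, v) \<in> (adj (underlying T))\<^sup>*" if "u \<in> V" "v \<in> V" for u v
    using functional_treeD(5)[OF T] that rtrancl_subset_adj[of T]
    by (meson adj_rtrancl_sym rtrancl_trans subsetD)
  ultimately show ?thesis
    using functional_tree_acyclic[OF T] asym functional_treeD(3,5)[OF T]
    by (auto simp: rooted_spanning_trees_def spanning_tree_def spanning_forest_def complete_graph_def)
qed

text \<open>Cut the walk at its first visit to \<open>x\<close>.\<close>

lemma rtrancl_stop_at_target:
  assumes "(y, x) \<in> R\<^sup>*"
  shows "(y, x) \<in> (R - {x} \<times> UNIV)\<^sup>*"
  using assms
proof (induction rule: converse_rtrancl_induct)
  case (step y z)
  then show ?case
    by (cases "y = x") (auto intro: converse_rtrancl_into_rtrancl)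
qed simp

text \<open>Each edge of \<open>T\<close> is a bridge of the undirected tree. A directed way back,
  or a second edge out of the same vertex, would join the ends of an edge without using it.\<close>

lemma rooted_spanning_tree_imp_functional_tree:
  assumes T: "T \<in> rooted_spanning_trees (complete_graph V) r" and r: "r \<in> V"
  shows "functional_tree V r T"
proof -
  define U where "U = underlying T"
  have U: "U \<subseteq> nsets V 2" and acyc: "\<not> (\<exists>xs. is_cycle U xs)"
    and conn: "\<And>u v. u \<in> V \<Longrightarrow> v \<in> V \<Longrightarrow> (u, v) \<in> (adj U)\<^sup>*"
    and asym: "\<And>u v. (u, v) \<in> T \<Longrightarrow> (v, u) \<notin> T"
    and to_root: "\<And>u v. (u, v) \<in> T \<Longrightarrow> (v, r) \<in> T\<^sup>*"
    using T by (auto simp: rooted_spanning_trees_def spanning_tree_def spanning_forest_def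
        complete_graph_def U_def)
  have in_V: "u \<in> V" "v \<in> V" "u \<noteq> v" if "(u, v) \<in> T" for u v
    using underlying_memI[OF that] U doubleton_in_nsets_2[of u v V] by (auto simp: U_def simp del: doubleton_in_nsets_2)
  have bridge: "(u, v) \<notin> (adj (U - {{u, v}}))\<^sup>*" if "(u, v) \<in> T" for u v
    using acyclic_edge_is_bridge[OF acyc] underlying_memI[OF that] in_V[OF that] by (simp add: U_def)
  \<comment> \<open>Stopped at its first arrival in \<open>u\<close>, the way back uses no edge out
    of \<open>u\<close>; as \<open>asym\<close> excludes the reverse edge, it never uses
    \<open>{u, v}\<close>.\<close>
  have no_return: "(v, u) \<notin> T\<^sup>*" if uv: "(u, v) \<in> T" for u v
  proof
    assume "(v, u) \<in> T\<^sup>*"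
    then have "(v, u) \<in> (T - {u} \<times> UNIV)\<^sup>*"
      by (rule rtrancl_stop_at_target)
    moreover have "T - {u} \<times> UNIV \<subseteq> adj (U - {{u, v}})"
      using asym[OF uv] by (auto simp: adj_def U_def underlying_memI doubleton_eq_iff)
    ultimately have "(v, u) \<in> (adj (U - {{u, v}}))\<^sup>*"
      using rtrancl_mono by blast
    then show False using bridge[OF uv] adj_rtrancl_sym by metis
  qed
  have sv: "v = w" if uv: "(u, v) \<in> T" and uw: "(u, w) \<in> T" for u v w
  proof (rule ccontr)
    assume "v \<noteq> w"
    \<comment> \<open>By \<open>no_return\<close> the directed way from \<open>v\<close> or
      \<open>w\<close> to the root never meets \<open>u\<close>. Hence \<open>u\<close>,
      \<open>w\<close>, root, \<open>v\<close> is a detour around \<open>{u, v}\<close>.\<close>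
    have avoid: "(x, r) \<in> (adj (U - {{u, v}}))\<^sup>*" if "(u, x) \<in> T" for x
    proof -
      have "(x, y) \<in> T\<^sup>* \<Longrightarrow> (x, y) \<in> (adj (U - {{u, v}}))\<^sup>*" for y
      proof (induction rule: rtrancl_induct)
        case (step y z)
        have "y \<noteq> u"
          using no_return[OF that] step.hyps(1) by blast
        moreover have "z \<noteq> u"
          using no_return[OF that] rtrancl_into_rtrancl[OF step.hyps] by blast
        ultimately have "(y, z) \<in> adj (U - {{u, v}})"
          using step.hyps(2) by (auto simp: adj_def U_def underlying_memI doubleton_eq_iff)
        then show ?case using step.IH by (rule rtrancl_into_rtrancl[rotated])
      qed simp
      then show ?thesis using to_root[OF that] .
    qed
    have "(u, w) \<in> adj (U - {{u, v}})"
      using underlying_memI[OF uw] \<open>v \<noteq> w\<close> by (auto simp: adj_def U_def doubleton_eq_iff)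
    then have "(u, r) \<in> (adj (U - {{u, v}}))\<^sup>*"
      using avoid[OF uw] by (rule converse_rtrancl_into_rtrancl)
    then have "(u, v) \<in> (adj (U - {{u, v}}))\<^sup>*"
      using adj_rtrancl_sym[OF avoid[OF uv]] by (rule rtrancl_trans)
    then show False using bridge[OF uv] by blast
  qed
  have not_root: "u \<noteq> r" if "(u, v) \<in> T" for u v
    using no_return[OF that] to_root[OF that] by blast
  have reach: "(v, r) \<in> T\<^sup>*" if v: "v \<in> V" for v
  proof (cases "v = r")
    case False
    then obtain w where "(v, w) \<in> adj U"
      using conn[OF v r] by (auto elim: converse_rtranclE)
    then have "(v, w) \<in> T \<or> (w, v) \<in> T"
      by (auto simp: adj_def U_def dest: underlying_memD)
    then show ?thesis
      using to_root by (auto intro: converse_rtrancl_into_rtrancl)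
  qed simp
  show ?thesis
    unfolding functional_tree_def
  proof (intro conjI ballI)
    show "T \<subseteq> (V - {r}) \<times> V"
    proof (rule subrelI)
      fix u v
      assume "(u, v) \<in> T"
      from in_V(1,2)[OF this] not_root[OF this] show "(u, v) \<in> (V - {r}) \<times> V" by simp
    qed
    show "single_valued T"
      using sv by (rule single_valuedI)
  qed (rule reach)
qed

lemma rooted_spanning_trees_complete_graph:
  "r \<in> V \<Longrightarrow> rooted_spanning_trees (complete_graph V) r = {T. functional_tree V r T}"
  by (intro set_eqI iffI CollectI; (elim CollectE)?)
    (rule rooted_spanning_tree_imp_functional_tree functional_tree_imp_rooted_spanning_tree; assumption)+

section \<open>Directing the edges of an undirected tree: uniqueness and existence\<close>

lemma functional_tree_subset:
  assumes T1: "functional_tree V r T1" and T2: "functional_tree V r T2"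
    and eq: "underlying T1 = underlying T2"
  shows "T1 \<subseteq> T2"
proof -
  obtain d :: "'a \<Rightarrow> nat" where d: "\<And>u v. (u, v) \<in> T1 \<Longrightarrow> d u = Suc (d v)"
    using functional_tree_depth[OF T1] by blast
  have "(u, v) \<in> T1 \<Longrightarrow> (u, v) \<in> T2" for u v
  proof (induction "d u" arbitrary: u v rule: less_induct)
    case less
    have "(u, v) \<in> T2 \<or> (v, u) \<in> T2"
      using underlying_memI[OF less.prems] eq underlying_memD by metis
    \<comment> \<open>If \<open>T2\<close> reversed the edge, the edge of \<open>T1\<close> out of
      the shallower vertex \<open>v\<close> would be in \<open>T2\<close> by induction. So
      \<open>u\<close> would be the parent of \<open>v\<close> in both, contradicting the
      depths.\<close>
    moreover have False if vu: "(v, u) \<in> T2"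
    proof -
      have "(v, r) \<in> T1\<^sup>*" "v \<noteq> r"
        using functional_treeD(3,5)[OF T1] less.prems functional_treeD(2)[OF T2 vu] by auto
      then obtain w where w: "(v, w) \<in> T1"
        by (auto elim: converse_rtranclE)
      then have "(v, w) \<in> T2"
        using less.hyps[of v w] d[OF less.prems] by simp
      then have "w = u"
        using functional_treeD(4)[OF T2 vu] by simp
      then show False using d[OF less.prems] d[OF w] by simp
    qed
    ultimately show ?case by blast
  qed
  then show ?thesis by auto
qed

lemma functional_tree_orientation_unique:
  assumes "functional_tree V r T1" "functional_tree V r T2" "underlying T1 = underlying T2"
  shows "T1 = T2"
  using assms functional_tree_subset by (metis subset_antisym)

lemma functional_tree_orientation_exists:
  assumes U: "U \<subseteq> nsets V 2" and r: "r \<in> V"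
    and bridge: "\<And>u v. {u, v} \<in> U \<Longrightarrow> (u, v) \<notin> (adj (U - {{u, v}}))\<^sup>*"
    and conn: "\<And>v. v \<in> V \<Longrightarrow> (v, r) \<in> (adj U)\<^sup>*"
  obtains T where "functional_tree V r T" "underlying T = U"
proof
  \<comment> \<open>Each edge points to the end that still reaches \<open>r\<close> once the edge is
    removed. By the bridge hypothesis, both ends cannot.\<close>
  define T where "T = {(u, v). {u, v} \<in> U \<and> (v, r) \<in> (adj (U - {{u, v}}))\<^sup>*}"
  have oriented: "(u, v) \<in> T \<or> (v, u) \<in> T" if "{u, v} \<in> U" for u v
  proof -
    have "v \<in> V" using that U by auto
    from conn[OF this] have "\<exists>w. (w = u \<or> w = v) \<and> (w, r) \<in> (adj (U - {{u, v}}))\<^sup>*"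
    proof (induction rule: rtrancl_induct)
      case (step y z)
      then show ?case
        by (cases "{y, z} = {u, v}")
          (auto simp: adj_def doubleton_eq_iff intro: rtrancl_into_rtrancl)
    qed auto
    then show ?thesis
      using that by (auto simp: T_def insert_commute)
  qed
  show und: "underlying T = U"
  proof
    show "underlying T \<subseteq> U" by (auto simp: T_def underlying_def)
    show "U \<subseteq> underlying T"
    proof
      fix e
      assume "e \<in> U"
      then obtain u v where "e = {u, v}" "{u, v} \<in> U"
        using U by (auto simp: nsets_def card_2_iff)
      then show "e \<in> underlying T"
        using oriented underlying_memI[of u v T] underlying_memI[of v u T]
        by (auto simp: insert_commute)
    qed
  qed
  have sv: "v = w" if uv: "(u, v) \<in> T" and uw: "(u, w) \<in> T" for u v w
  proof (rule ccontr)
    assume "v \<noteq> w"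
    let ?E = "U - {{u, w}}"
    have edges: "{u, v} \<in> U" "{u, w} \<in> U"
      and v: "(v, r) \<in> (adj (U - {{u, v}}))\<^sup>*" and w: "(w, r) \<in> (adj ?E)\<^sup>*"
      using uv uw by (auto simp: T_def)
    have nw: "(u, v) \<in> adj ?E"
      using edges \<open>v \<noteq> w\<close> by (auto simp: adj_def doubleton_eq_iff)
    have sub: "U - {{u, v}} - {{u, w}} \<subseteq> ?E" "U - {{u, v}} - {{u, w}} \<subseteq> U - {{u, v}}" by auto
    \<comment> \<open>Remove \<open>{u, w}\<close> as well and see where the way from
      \<open>v\<close> ends. At \<open>r\<close>: then \<open>u\<close>, \<open>v\<close>,
      \<open>r\<close>, \<open>w\<close> avoids \<open>{u, w}\<close>. At \<open>u\<close>: then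
      \<open>v\<close> and \<open>u\<close> are joined without \<open>{u, v}\<close>. At
      \<open>w\<close>: then \<open>u\<close>, \<open>v\<close>, \<open>w\<close> avoids
      \<open>{u, w}\<close>.\<close>
    from rtrancl_delete_edge[OF v, of u w] show False
    proof (elim disjE)
      assume "(v, r) \<in> (adj (U - {{u, v}} - {{u, w}}))\<^sup>*"
      then have "(u, r) \<in> (adj ?E)\<^sup>*"
        using nw adj_rtrancl_mono[OF _ sub(1)] by (meson converse_rtrancl_into_rtrancl)
      then show False
        using bridge[OF edges(2)] adj_rtrancl_sym[OF w] by (meson rtrancl_trans)
    next
      assume "(v, u) \<in> (adj (U - {{u, v}} - {{u, w}}))\<^sup>*"
      then show False
        using bridge[OF edges(1)] adj_rtrancl_mono[OF _ sub(2)] adj_rtrancl_sym by metis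
    next
      assume "(v, w) \<in> (adj (U - {{u, v}} - {{u, w}}))\<^sup>*"
      then show False
        using nw bridge[OF edges(2)] adj_rtrancl_mono[OF _ sub(1)]
        by (meson converse_rtrancl_into_rtrancl)
    qed
  qed
  have not_root: "u \<noteq> r" if "(u, v) \<in> T" for u v
    using that bridge[of u v] adj_rtrancl_sym by (fastforce simp: T_def)
  have "(v, r) \<in> T\<^sup>*" if "(v, r) \<in> (adj U)\<^sup>*" for v
    using that
  proof (induction rule: converse_rtrancl_induct)
    case (step v w)
    then have "(v, w) \<in> T \<or> (w, v) \<in> T"
      using oriented by (auto simp: adj_def)
    then show ?case
    proof
      \<comment> \<open>The edge points from \<open>w\<close> to \<open>v\<close>. Since
        \<open>w\<close> has no other edge out, its directed way to the root starts with
        \<open>v\<close>.\<close>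
      assume "(w, v) \<in> T"
      then have "w \<noteq> r" by (rule not_root)
      then obtain w' where "(w, w') \<in> T" "(w', r) \<in> T\<^sup>*"
        using step.IH by (auto elim: converse_rtranclE)
      then show ?thesis using sv[OF \<open>(w, v) \<in> T\<close>] by blast
    qed (use step.IH in \<open>auto intro: converse_rtrancl_into_rtrancl\<close>)
  qed simp
  moreover have "T \<subseteq> V \<times> V"
    using U by (auto simp: T_def)
  ultimately show "functional_tree V r T"
    using sv not_root conn unfolding functional_tree_def single_valued_def by blast
qed

section \<open>Rooted spanning forests\<close>

lemma cone_complete_graph: "cone (complete_graph A) = complete_graph (insert None (Some ` A))"
proof -
  have "(\<lambda>e. Some ` e) ` nsets A 2 \<union> {{Some v, None} | v. v \<in> A} = nsets (insert None (Some ` A)) 2"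
    (is "?L = ?R")
  proof
    show "?L \<subseteq> ?R"
      by (auto elim!: nsets2_E)
    show "?R \<subseteq> ?L"
    proof
      fix e
      assume "e \<in> ?R"
      then obtain x y where "e = {x, y}" "x \<noteq> y" "x \<in> insert None (Some ` A)" "y \<in> insert None (Some ` A)"
        by (auto simp: nsets_2_eq)
      moreover have "{Some a, Some b} \<in> (\<lambda>e. Some ` e) ` nsets A 2" if "a \<in> A" "b \<in> A" "a \<noteq> b" for a b
        using that by (intro image_eqI[of _ _ "{a, b}"]) auto
      ultimately show "e \<in> ?L" by (auto simp: insert_commute)
    qed
  qed
  then show ?thesis by (simp add: cone_def complete_graph_def)
qed

section \<open>Undirected cone trees versus rooted forests\<close>

abbreviation add_root :: "'a set \<Rightarrow> 'a option set" where
  "add_root A \<equiv> insert None (Some ` A)"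

text \<open>Undoes \<open>delete_root\<close> up to directions: the pair does not remember how the
  inner edges were directed, so only the undirected edge set of the cone tree can be rebuilt. The
  directions come back through the orientation lemmas.\<close>

definition attach_root :: "'a set set \<times> 'a set \<Rightarrow> 'a option set set" where
  "attach_root FR = (\<lambda>e. Some ` e) ` fst FR \<union> (\<lambda>i. {Some i, None}) ` snd FR"

lemma attach_root_Some:
  "{Some i, Some j} \<in> attach_root (F, R) \<longleftrightarrow> {i, j} \<in> F"
proof -
  have "{Some i, Some j} = Some ` e \<longleftrightarrow> e = {i, j}" for e
    using inj_image_eq_iff[of Some e "{i, j}"] by auto
  then have "{Some i, Some j} \<in> (\<lambda>e. Some ` e) ` F \<longleftrightarrow> {i, j} \<in> F"
    by (simp add: image_iff)
  then show ?thesis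
    by (auto simp: attach_root_def doubleton_eq_iff)
qed

lemma attach_root_None:
  "{Some i, None} \<in> attach_root (F, R) \<longleftrightarrow> i \<in> R"
  "{None, Some i} \<in> attach_root (F, R) \<longleftrightarrow> i \<in> R"
proof -
  have "{Some i, None} \<notin> (\<lambda>e. Some ` e) ` F" by (metis image_iff insertCI option.distinct(1))
  then show "{Some i, None} \<in> attach_root (F, R) \<longleftrightarrow> i \<in> R"
    unfolding attach_root_def by (simp add: image_iff doubleton_eq_iff)
  then show "{None, Some i} \<in> attach_root (F, R) \<longleftrightarrow> i \<in> R"
    by (simp add: insert_commute)
qed

lemma attach_root_None_None: "{None, None} \<notin> attach_root (F, R)"
  by (auto simp: attach_root_def doubleton_eq_iff)

lemma underlying_eq_attach_root:
  assumes T: "functional_tree (add_root A) None T"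
  shows "underlying T = attach_root (delete_root T)"
proof
  show "underlying T \<subseteq> attach_root (delete_root T)"
  proof
    fix e
    assume "e \<in> underlying T"
    then obtain u v where uv: "e = {u, v}" "(u, v) \<in> T" by (auto simp: underlying_def)
    then obtain i where i: "u = Some i" using functional_treeD(2)[OF T] by blast
    show "e \<in> attach_root (delete_root T)"
      using uv i by (cases v) (auto simp: delete_root_def attach_root_None attach_root_Some)
  qed
  show "attach_root (delete_root T) \<subseteq> underlying T"
    by (auto simp: attach_root_def delete_root_def underlying_def)
qed

lemma delete_root_eq_if_underlying_eq:
  assumes T: "functional_tree (add_root A) None T" and eq: "underlying T = attach_root (F, R)"
    and F: "F \<subseteq> nsets A 2"
  shows "delete_root T = (F, R)"
proof -
  have "{i. (Some i, None) \<in> T} = R"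
    using functional_treeD(2)[OF T] attach_root_None[of _ F R]
    by (auto simp flip: eq dest: underlying_memD intro: underlying_memI)
  moreover have "{{i, j} | i j. (Some i, Some j) \<in> T} = F"
  proof
    show "{{i, j} | i j. (Some i, Some j) \<in> T} \<subseteq> F"
      using attach_root_Some[of _ _ F R] by (auto simp flip: eq intro: underlying_memI)
    show "F \<subseteq> {{i, j} | i j. (Some i, Some j) \<in> T}"
    proof
      fix e
      assume e: "e \<in> F"
      then have "e \<in> nsets A 2" using F by blast
      then obtain i j where ij: "e = {i, j}" by (auto elim: nsets2_E)
      then have "{Some i, Some j} \<in> underlying T"
        using e by (simp add: eq attach_root_Some)
      then show "e \<in> {{i, j} | i j. (Some i, Some j) \<in> T}"
        using ij by (auto dest!: underlying_memD)
    qed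
  qed
  ultimately show ?thesis by (simp add: delete_root_def)
qed

text \<open>With the empty set of roots the lifted walk avoids \<open>None\<close>, so it survives
  the deletion of any edge at \<open>None\<close>.\<close>

lemma adj_forest_to_tree:
  "(i, j) \<in> (adj F)\<^sup>* \<Longrightarrow> (Some i, Some j) \<in> (adj (attach_root (F, {})))\<^sup>*"
proof (induction rule: rtrancl_induct)
  case (step j k)
  then have "(Some j, Some k) \<in> adj (attach_root (F, {}))"
    by (simp add: adj_def attach_root_Some)
  then show ?case using step.IH by (rule rtrancl_into_rtrancl[rotated])
qed simp

text \<open>A component has a root because the directed way to \<open>None\<close> leaves it through
  one. Two roots would be joined inside the forest, giving a way from one of them to
  \<open>None\<close> around its own edge.\<close>

lemma delete_root_in_rooted_spanning_forests:
  assumes T: "functional_tree (add_root A) None T"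
  shows "delete_root T \<in> rooted_spanning_forests (complete_graph A)"
proof -
  obtain F R where FR: "delete_root T = (F, R)" by force
  have U: "underlying T = attach_root (F, R)"
    using underlying_eq_attach_root[OF T] FR by simp
  have F_def: "F = {{i, j} | i j. (Some i, Some j) \<in> T}" and R_def: "R = {i. (Some i, None) \<in> T}"
    using FR by (auto simp: delete_root_def)
  have "T \<in> rooted_spanning_trees (complete_graph (add_root A)) None"
    using T by (rule functional_tree_imp_rooted_spanning_tree)
  then have U2: "underlying T \<subseteq> nsets (add_root A) 2"
    by (simp add: rooted_spanning_trees_def spanning_tree_def spanning_forest_def complete_graph_def)
  have R: "R \<subseteq> A"
    using functional_treeD(1)[OF T] by (auto simp: R_def)
  have F: "F \<subseteq> nsets A 2"
  proof
    fix e
    assume "e \<in> F"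
    then obtain i j where ij: "e = {i, j}" "(Some i, Some j) \<in> T" by (auto simp: F_def)
    have "{Some i, Some j} \<in> nsets (add_root A) 2"
      using U2 underlying_memI[OF ij(2)] by (rule subsetD)
    then show "e \<in> nsets A 2" using ij by auto
  qed
  have acyclic: "\<not> is_cycle (underlying T) xs" for xs
    by (rule functional_tree_acyclic[OF T])
  have "\<not> is_cycle F xs" for xs
  proof
    assume cyc: "is_cycle F xs"
    have "{map Some xs ! i, map Some xs ! (Suc i mod length xs)} \<in> underlying T"
      if i: "i < length xs" for i
    proof -
      have "Suc i mod length xs < length xs"
        using i by (intro mod_less_divisor) auto
      then show ?thesis using cyc i by (simp add: is_cycle_def U attach_root_Some)
    qed
    then have "is_cycle (underlying T) (map Some xs)"
      using cyc by (simp add: is_cycle_def distinct_map)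
    then show False using acyclic by blast
  qed
  moreover have "\<exists>!r. r \<in> R \<and> (v, r) \<in> (adj F)\<^sup>*" if v: "v \<in> A" for v
  proof (rule ex_ex1I)
    have "(Some v, None) \<in> T\<^sup>*"
      using functional_treeD(5)[OF T] v by simp
    \<comment> \<open>\<open>u\<close> stands for \<open>Some v\<close> so that the induction may
      start at any vertex; at \<open>None\<close> nothing is claimed.\<close>
    then have "u \<noteq> None \<longrightarrow> (\<exists>r. r \<in> R \<and> (the u, r) \<in> (adj F)\<^sup>*)" if "u = Some v" for u
      unfolding that[symmetric]
    proof (induction rule: converse_rtrancl_induct)
      case (step y z)
      show ?case
      proof (cases z)
        case None
        then show ?thesis
          using step.hyps(1) by (cases y) (auto simp: R_def)
      next
        case (Some j)
        then obtain i where i: "y = Some i"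
          using step.hyps(1) functional_treeD(2)[OF T] by blast
        then have "(i, j) \<in> adj F"
          using step.hyps(1) Some by (auto simp: adj_def F_def)
        then show ?thesis
          using step.IH Some i by (auto intro: converse_rtrancl_into_rtrancl)
      qed
    qed simp
    then show "\<exists>r. r \<in> R \<and> (v, r) \<in> (adj F)\<^sup>*" by simp
  next
    fix r s
    assume r: "r \<in> R \<and> (v, r) \<in> (adj F)\<^sup>*" and s: "s \<in> R \<and> (v, s) \<in> (adj F)\<^sup>*"
    show "r = s"
    proof (rule ccontr)
      assume "r \<noteq> s"
      let ?E = "underlying T - {{Some r, None}}"
      have "(r, s) \<in> (adj F)\<^sup>*"
        using r s adj_rtrancl_sym by (meson rtrancl_trans)
      then have "(Some r, Some s) \<in> (adj (attach_root (F, {})))\<^sup>*"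
        by (rule adj_forest_to_tree)
      moreover have "attach_root (F, {}) \<subseteq> ?E"
        unfolding U by (auto simp: attach_root_def)
      ultimately have "(Some r, Some s) \<in> (adj ?E)\<^sup>*"
        by (rule adj_rtrancl_mono)
      moreover have "(Some s, None) \<in> adj ?E"
        using s \<open>r \<noteq> s\<close> by (auto simp: adj_def U attach_root_None doubleton_eq_iff)
      ultimately have "(Some r, None) \<in> (adj ?E)\<^sup>*"
        by (rule rtrancl_into_rtrancl)
      moreover have "{Some r, None} \<in> underlying T"
        using r by (simp add: U attach_root_None)
      ultimately show False
        using acyclic_edge_is_bridge[of "underlying T" "Some r" None] acyclic by auto
    qed
  qed
  ultimately show ?thesis
    using F R by (simp add: FR rooted_spanning_forests_def spanning_forest_def complete_graph_def)
qed

text \<open>An edge at \<open>None\<close> is a bridge because the component of \<open>i\<close>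
  contains no other root. For an inner edge, a detour may pass through \<open>None\<close>; it then
  leaves and returns by roots of the same component. These coincide, so the part through
  \<open>None\<close> can be skipped.\<close>

lemma attach_root_bridge:
  assumes F: "F \<subseteq> nsets A 2" and acyclic: "\<not> (\<exists>xs. is_cycle F xs)" and R: "R \<subseteq> A"
    and root: "\<And>v r s. v \<in> A \<Longrightarrow> r \<in> R \<Longrightarrow> s \<in> R \<Longrightarrow> (v, r) \<in> (adj F)\<^sup>* \<Longrightarrow> (v, s) \<in> (adj F)\<^sup>* \<Longrightarrow> r = s"
    and e: "{u, v} \<in> attach_root (F, R)"
  shows "(u, v) \<notin> (adj (attach_root (F, R) - {{u, v}}))\<^sup>*"
proof -
  have to_None: "(Some i, None) \<notin> (adj (attach_root (F, R) - {{Some i, None}}))\<^sup>*"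
    if i: "i \<in> R" for i
  proof -
    have "\<exists>j. y = Some j \<and> (i, j) \<in> (adj F)\<^sup>*"
      if "(Some i, y) \<in> (adj (attach_root (F, R) - {{Some i, None}}))\<^sup>*" for y
      using that
    proof (induction rule: rtrancl_induct)
      case (step y z)
      then obtain j where j: "y = Some j" "(i, j) \<in> (adj F)\<^sup>*" by blast
      show ?case
      proof (cases z)
        case None
        then have "j \<in> R" "j \<noteq> i"
          using step.hyps(2) j by (auto simp: adj_def attach_root_None)
        then show ?thesis using root[of i i j] i R j by auto
      next
        case (Some k)
        then have "(j, k) \<in> adj F"
          using step.hyps(2) j by (auto simp: adj_def attach_root_Some)
        then show ?thesis using j Some by (auto intro: rtrancl_into_rtrancl)
      qed
    qed simp
    then show ?thesis by blast
  qed
  have inner: "(Some i, Some j) \<notin> (adj (attach_root (F, R) - {{Some i, Some j}}))\<^sup>*"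
    if ij: "{i, j} \<in> F" for i j
  proof
    let ?E = "F - {{i, j}}"
    assume "(Some i, Some j) \<in> (adj (attach_root (F, R) - {{Some i, Some j}}))\<^sup>*"
    \<comment> \<open>Invariant along the walk: \<open>r\<close> is a root by which it can leave for
      \<open>None\<close>, \<open>s\<close> one by which it came back, however often it passed
      \<open>None\<close>.\<close>
    then have "case Some j of
        None \<Rightarrow> \<exists>r\<in>R. (i, r) \<in> (adj ?E)\<^sup>*
      | Some k \<Rightarrow> (i, k) \<in> (adj ?E)\<^sup>* \<or> (\<exists>r\<in>R. \<exists>s\<in>R. (i, r) \<in> (adj ?E)\<^sup>* \<and> (s, k) \<in> (adj ?E)\<^sup>*)"
    proof (induction rule: rtrancl_induct)
      case (step y z)
      have yz: "{y, z} \<in> attach_root (F, R)" "{y, z} \<noteq> {Some i, Some j}"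
        using step.hyps(2) by (auto simp: adj_def)
      show ?case
      proof (cases z)
        case None
        then obtain k where k: "y = Some k" "k \<in> R"
          using yz attach_root_None_None by (cases y) (auto simp: attach_root_None)
        then show ?thesis using step.IH None by auto
      next
        case z: (Some m)
        show ?thesis
        proof (cases y)
          case None
          then have "m \<in> R" using yz z by (auto simp: attach_root_None)
          then show ?thesis using step.IH z None by auto
        next
          case (Some k)
          then have km: "(k, m) \<in> adj ?E"
            using yz z by (auto simp: adj_def attach_root_Some doubleton_eq_iff)
          then show ?thesis
            using step.IH z Some by (auto intro: rtrancl_into_rtrancl)
        qed
      qed
    qed simp
    then consider "(i, j) \<in> (adj ?E)\<^sup>*"
      | r s where "r \<in> R" "s \<in> R" "(i, r) \<in> (adj ?E)\<^sup>*" "(s, j) \<in> (adj ?E)\<^sup>*"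
      by auto
    then have "(i, j) \<in> (adj ?E)\<^sup>*"
    proof cases
      case 2
      have "i \<in> A" using F ij by auto
      moreover have "(i, j) \<in> (adj F)\<^sup>*" using ij by (auto simp: adj_def)
      moreover have "(i, r) \<in> (adj F)\<^sup>*" "(j, s) \<in> (adj F)\<^sup>*"
        using 2 adj_rtrancl_mono[of _ _ ?E F] adj_rtrancl_sym[of s j] by auto
      ultimately have "r = s"
        using root 2 by (meson rtrancl_trans)
      then show ?thesis using 2 by (meson rtrancl_trans)
    qed
    moreover have "i \<noteq> j" using F ij by (metis doubleton_in_nsets_2 subsetD)
    ultimately show False
      using acyclic_edge_is_bridge[OF acyclic ij] by blast
  qed
  show ?thesis
  proof (cases u)
    case None
    then obtain i where "v = Some i" "i \<in> R"
      using e attach_root_None_None by (cases v) (auto simp: attach_root_None)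
    then show ?thesis
      using to_None[of i] None adj_rtrancl_sym[of None "Some i"] by (auto simp: insert_commute)
  next
    case (Some i)
    then show ?thesis
      using e to_None inner by (cases v) (auto simp: attach_root_None attach_root_Some)
  qed
qed

text \<open>All edges of \<open>attach_root (F, R)\<close> are bridges and every vertex reaches
  \<open>None\<close>, so they can be directed towards \<open>None\<close>.\<close>

lemma rooted_spanning_forest_is_delete_root:
  assumes "(F, R) \<in> rooted_spanning_forests (complete_graph A)"
  obtains T where "functional_tree (add_root A) None T" "delete_root T = (F, R)"
proof -
  let ?U = "attach_root (F, R)"
  have F: "F \<subseteq> nsets A 2" and acyclic: "\<not> (\<exists>xs. is_cycle F xs)" and R: "R \<subseteq> A"
    and root: "\<And>v. v \<in> A \<Longrightarrow> \<exists>!r. r \<in> R \<and> (v, r) \<in> (adj F)\<^sup>*"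
    using assms by (auto simp: rooted_spanning_forests_def spanning_forest_def complete_graph_def)
  have "?U \<subseteq> nsets (add_root A) 2"
    using F R by (fastforce simp: attach_root_def nsets_2_eq)
  moreover have "(u, v) \<notin> (adj (?U - {{u, v}}))\<^sup>*" if "{u, v} \<in> ?U" for u v
  proof (rule attach_root_bridge[OF F acyclic R _ that])
    fix v r s
    assume "v \<in> A" "r \<in> R" "s \<in> R" "(v, r) \<in> (adj F)\<^sup>*" "(v, s) \<in> (adj F)\<^sup>*"
    then show "r = s" using root by blast
  qed
  moreover have "(v, None) \<in> (adj ?U)\<^sup>*" if v: "v \<in> add_root A" for v
  proof (cases v)
    case (Some i)
    then obtain r where r: "r \<in> R" "(i, r) \<in> (adj F)\<^sup>*"
      using root[of i] v by auto
    have "(Some i, Some r) \<in> (adj ?U)\<^sup>*"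
      by (rule adj_rtrancl_mono[OF adj_forest_to_tree[OF r(2)]]) (auto simp: attach_root_def)
    moreover have "(Some r, None) \<in> adj ?U"
      using r by (simp add: adj_def attach_root_None)
    ultimately show ?thesis using Some by (auto intro: rtrancl_into_rtrancl)
  qed simp
  ultimately obtain T where T: "functional_tree (add_root A) None T" "underlying T = ?U"
    using functional_tree_orientation_exists[of ?U "add_root A" None] by blast
  then show thesis
    using that delete_root_eq_if_underlying_eq[OF T F] by blast
qed

lemma bij_betw_delete_root:
  "bij_betw delete_root {T. functional_tree (add_root A) None T}
     (rooted_spanning_forests (complete_graph A))"
proof (rule bij_betw_imageI)
  show "inj_on delete_root {T. functional_tree (add_root A) None T}"
    using functional_tree_orientation_unique underlying_eq_attach_root
    by (smt (verit) inj_onI mem_Collect_eq)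
  show "delete_root ` {T. functional_tree (add_root A) None T} =
      rooted_spanning_forests (complete_graph A)"
  proof
    show "delete_root ` {T. functional_tree (add_root A) None T}
        \<subseteq> rooted_spanning_forests (complete_graph A)"
      using delete_root_in_rooted_spanning_forests by blast
    show "rooted_spanning_forests (complete_graph A)
        \<subseteq> delete_root ` {T. functional_tree (add_root A) None T}"
    proof
      fix x
      assume x: "x \<in> rooted_spanning_forests (complete_graph A)"
      obtain F R where FR: "x = (F, R)" by force
      obtain T where "functional_tree (add_root A) None T" "delete_root T = (F, R)"
        using rooted_spanning_forest_is_delete_root x FR by metis
      then show "x \<in> delete_root ` {T. functional_tree (add_root A) None T}"
        using FR by force
    qed
  qed
qed

section \<open>Tree labellings\<close>

text \<open>Indices along the path from the root to a vertex, the vertex itself included; prefixes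
  are ancestors. A word determines its vertex for arbitrary \<open>T\<close>, the converse is proved
  for trees.\<close>

inductive tree_word :: "('a option \<times> 'a option) set \<Rightarrow> 'a option \<Rightarrow> 'a list \<Rightarrow> bool"
  for T where
  root: "tree_word T None []"
| child: "tree_word T v w \<Longrightarrow> (Some i, v) \<in> T \<Longrightarrow> tree_word T (Some i) (w @ [i])"

inductive_cases tree_word_NilE: "tree_word T v []"

lemma tree_word_NoneD: "tree_word T None w \<Longrightarrow> w = []"
  by (cases rule: tree_word.cases) auto

lemma tree_word_snocE:
  assumes "tree_word T v (w @ [i])"
  obtains u where "v = Some i" "tree_word T u w" "(Some i, u) \<in> T"
  using assms by (cases rule: tree_word.cases) auto

lemma tree_word_appendE:
  assumes "tree_word T v (w @ w')"
  obtains u where "tree_word T u w"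
  using assms
proof (induction w' arbitrary: v thesis rule: rev_induct)
  case (snoc i w')
  then show ?case by (metis append_assoc tree_word_snocE)
qed simp

lemma tree_word_inj:
  assumes "tree_word T u w" "tree_word T v w"
  shows "u = v"
proof (cases w rule: rev_cases)
  case Nil
  then show ?thesis using assms by (auto elim: tree_word_NilE)
next
  case (snoc w' i)
  then show ?thesis using assms by (metis tree_word_snocE)
qed

lemma tree_word_unique:
  assumes T: "functional_tree V None T"
  shows "tree_word T v w \<Longrightarrow> tree_word T v w' \<Longrightarrow> w = w'"
proof (induction arbitrary: w' rule: tree_word.induct)
  case root
  then show ?case using tree_word_NoneD by metis
next
  case (child v w i)
  from child.prems show ?case
  proof (cases rule: tree_word.cases)
    case (child v' w'')
    then show ?thesis
      using \<open>(Some i, v) \<in> T\<close> functional_treeD(4)[OF T] child.IH by metis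
  qed
qed

lemma tree_word_exists:
  assumes T: "functional_tree V None T" and v: "v \<in> V"
  shows "\<exists>w. tree_word T v w"
  using functional_treeD(5)[OF T v]
proof (induction rule: converse_rtrancl_induct)
  case base
  show ?case using tree_word.root by blast
next
  case (step y z)
  then obtain i where "y = Some i" using functional_treeD(2)[OF T] by blast
  then show ?case using step tree_word.child by metis
qed

definition word_of :: "('a option \<times> 'a option) set \<Rightarrow> 'a option \<Rightarrow> 'a list" where
  "word_of T v = (THE w. tree_word T v w)"

lemma word_of_eq:
  assumes "functional_tree V None T" "tree_word T v w"
  shows "word_of T v = w"
  unfolding word_of_def using assms tree_word_unique by (metis the_equality)

lemma tree_word_word_of:
  assumes "functional_tree V None T" "v \<in> V"
  shows "tree_word T v (word_of T v)"
  using tree_word_exists[OF assms] word_of_eq[OF assms(1)] by metis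

lemma word_of_child:
  assumes T: "functional_tree V None T" and e: "(Some i, v) \<in> T"
  shows "word_of T (Some i) = word_of T v @ [i]"
  using word_of_eq[OF T tree_word.child[OF tree_word_word_of[OF T] e]] functional_treeD(3)[OF T e]
  by blast

lemma inj_on_word_of:
  assumes "functional_tree V None T"
  shows "inj_on (word_of T) V"
  using tree_word_word_of[OF assms] tree_word_inj by (metis inj_onI)

text \<open>The defining conditions of a tree labelling say that it lists the vertices in depth-first
  preorder, visiting the children of a vertex by decreasing index. Reading a vertex as the word of
  indices on its path from the root, this is the lexicographic order for the reversed order of
  indices.\<close>

definition preorder :: "(nat list \<times> nat list) set" where
  "preorder = lexord {(a, b). b < a}"

lemma preorder_irrefl: "(w, w) \<notin> preorder"
  unfolding preorder_def by (rule lexord_irreflexive) simp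

lemma preorder_trans: "(u, v) \<in> preorder \<Longrightarrow> (v, w) \<in> preorder \<Longrightarrow> (u, w) \<in> preorder"
  unfolding preorder_def by (rule lexord_trans) (auto simp: trans_def)

lemma preorder_total: "u \<noteq> v \<Longrightarrow> (u, v) \<in> preorder \<or> (v, u) \<in> preorder"
proof -
  assume "u \<noteq> v"
  moreover have "total {(a, b::nat). b < a}" by (auto simp: total_on_def)
  from total_lexord[OF this] have "total preorder" by (simp add: preorder_def)
  ultimately show ?thesis by (simp add: total_on_def)
qed

lemma preorder_prefix: "(w, w @ i # v) \<in> preorder"
  unfolding preorder_def by (rule lexord_append_rightI) blast

lemma preorder_branch: "j < i \<Longrightarrow> (w @ i # u, w @ j # v) \<in> preorder"
  unfolding preorder_def by (rule lexord_append_left_rightI) simp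

lemma preorderE:
  assumes "(u, v) \<in> preorder"
  obtains (prefix) i z where "v = u @ i # z"
  | (branch) w i j y z where "j < i" "u = w @ i # y" "v = w @ j # z"
  using assms unfolding preorder_def lexord_def by auto

text \<open>The words starting with \<open>y\<close> are the subtree of \<open>y\<close>. If
  \<open>y\<close> comes between \<open>x\<close> and its child \<open>x @ [a]\<close>, it already
  differs from that child in some letter, so the whole subtree of \<open>y\<close> comes before it.
  This is the noncrossing condition on arcs in terms of words.\<close>

lemma preorder_subtree_before:
  assumes xy: "(x, y) \<in> preorder" and yx: "(y, x @ [a]) \<in> preorder"
  shows "(y @ z, x @ [a]) \<in> preorder"
  using yx
proof (cases rule: preorderE)
  case (prefix i v)
  then have "x = y \<or> (\<exists>j w. x = y @ j # w)"
    by (metis append_Nil2 append_butlast_last_id butlast.simps(2) butlast_append butlast_snoc list.distinct(1) neq_Nil_conv)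
  then have False
    using xy preorder_prefix preorder_trans preorder_irrefl by metis
  then show ?thesis ..
next
  case (branch w i j y' z')
  then show ?thesis using preorder_branch[of j i w "y' @ z" z'] by simp
qed

section \<open>Ranks in a finite set of words\<close>

definition rank_in :: "'v set \<Rightarrow> ('v \<Rightarrow> nat list) \<Rightarrow> 'v \<Rightarrow> nat" where
  "rank_in V f v = card {u \<in> V. (f u, f v) \<in> preorder}"

lemma rank_in_mono:
  assumes "finite V" "u \<in> V" "(f u, f v) \<in> preorder"
  shows "rank_in V f u < rank_in V f v"
  unfolding rank_in_def
proof (rule psubset_card_mono)
  show "finite {u \<in> V. (f u, f v) \<in> preorder}" using assms by simp
  show "{w \<in> V. (f w, f u) \<in> preorder} \<subset> {w \<in> V. (f w, f v) \<in> preorder}"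
    using assms preorder_trans preorder_irrefl by blast
qed

lemma rank_in_less_iff:
  assumes "finite V" "inj_on f V" "u \<in> V" "v \<in> V"
  shows "rank_in V f u < rank_in V f v \<longleftrightarrow> (f u, f v) \<in> preorder"
proof
  assume less: "rank_in V f u < rank_in V f v"
  then have "f u \<noteq> f v" by (auto simp: rank_in_def)
  then show "(f u, f v) \<in> preorder"
    using less rank_in_mono[OF assms(1,4), of f u] preorder_total[of "f u" "f v"] by auto
qed (rule rank_in_mono[OF assms(1,3)])

lemma bij_betw_rank_in:
  assumes "finite V" "inj_on f V"
  shows "bij_betw (rank_in V f) V {..<card V}"
proof -
  have inj: "inj_on (rank_in V f) V"
  proof (rule inj_onI)
    fix u v
    assume uv: "u \<in> V" "v \<in> V" "rank_in V f u = rank_in V f v"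
    then show "u = v"
      using rank_in_less_iff[OF assms, of u v] rank_in_less_iff[OF assms, of v u] preorder_total
        inj_onD[OF assms(2)] by (metis less_irrefl)
  qed
  have "rank_in V f v < card V" if "v \<in> V" for v
    unfolding rank_in_def
  proof (rule psubset_card_mono[OF assms(1)])
    show "{u \<in> V. (f u, f v) \<in> preorder} \<subset> V"
      using that preorder_irrefl[of "f v"] by blast
  qed
  then have "rank_in V f ` V \<subseteq> {..<card V}" by auto
  then have "rank_in V f ` V = {..<card V}"
    using inj by (intro card_subset_eq) (auto simp: card_image)
  with inj show ?thesis by (rule bij_betw_imageI)
qed

lemma card_cone_vertices: "card (cone_vertices n) = Suc n"
  by (simp add: card_image)

section \<open>Existence and uniqueness of the tree labelling\<close>

context
  fixes n :: nat and T :: "(nat option \<times> nat option) set"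
  assumes T: "functional_tree (cone_vertices n) None T"
begin

text \<open>The conditions on edges, siblings and crossings are \<open>preorder_prefix\<close>,
  \<open>preorder_branch\<close> and \<open>preorder_subtree_before\<close> for the words of the
  vertices.\<close>

lemma is_tree_label_rank:
  "is_tree_label n T (restrict (rank_in (cone_vertices n) (word_of T)) (cone_vertices n))"
  (is "is_tree_label n T ?p")
proof -
  define V where "V = cone_vertices n"
  define r where "r = rank_in V (word_of T)"
  define p where "p = restrict r V"
  have fin: "finite V" by (simp add: V_def)
  have T': "functional_tree V None T" using T by (simp add: V_def)
  note inj = inj_on_word_of[OF T']
  have p: "p v = r v" if "v \<in> V" for v
    using that by (simp add: p_def)
  have less_iff: "p u < p v \<longleftrightarrow> (word_of T u, word_of T v) \<in> preorder" if "u \<in> V" "v \<in> V" for u v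
    using rank_in_less_iff[OF fin inj that] that by (simp add: p r_def)
  have V: "u \<in> V" "v \<in> V" if "(u, v) \<in> T" for u v
    using functional_treeD(1,3)[OF T' that] .
  have word: "\<exists>i. u = Some i \<and> word_of T u = word_of T v @ [i]" if "(u, v) \<in> T" for u v
    using that word_of_child[OF T'] functional_treeD(2)[OF T' that] by blast
  have down: "p v < p u" if uv: "(u, v) \<in> T" for u v
    using word[OF uv] less_iff[OF V(2,1)[OF uv]] preorder_prefix[of "word_of T v" _ "[]"] by auto
  have siblings: "p (Some j) < p (Some i)" if "(Some i, k) \<in> T" "(Some j, k) \<in> T" "i < j" for i j k
    using word_of_child[OF T' that(1)] word_of_child[OF T' that(2)]
      less_iff[OF V(1)[OF that(2)] V(1)[OF that(1)]]
      preorder_branch[OF that(3), of "word_of T k" "[]" "[]"] by simp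
  have noncrossing: False
    if e: "(u, v) \<in> T" and e': "(u', v') \<in> T" and lt: "p v < p v'" "p v' < p u" "p u < p u'"
    for u v u' v'
  proof -
    obtain i j where ij: "word_of T u = word_of T v @ [i]" "word_of T u' = word_of T v' @ [j]"
      using word e e' by blast
    have "(word_of T v, word_of T v') \<in> preorder" "(word_of T v', word_of T u) \<in> preorder"
      "(word_of T u, word_of T u') \<in> preorder"
      using lt V[OF e] V[OF e'] less_iff by simp_all
    then show False
      using ij preorder_subtree_before preorder_trans preorder_irrefl by metis
  qed
  have "bij_betw r V {..<Suc n}"
    using bij_betw_rank_in[OF fin inj] card_cone_vertices[of n] by (simp only: r_def V_def)
  then have "bij_betw p V {0..n}"
    by (simp add: p_def bij_betw_restrict_eq lessThan_Suc_atMost atMost_atLeast0)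
  moreover have "p \<in> extensional V" by (simp add: p_def)
  ultimately have "is_tree_label n T p"
    unfolding is_tree_label_def V_def using down siblings noncrossing by blast
  then show ?thesis by (simp only: p_def r_def V_def)
qed

lemma is_tree_label_ancestor:
  assumes p: "is_tree_label n T p" and u: "tree_word T u w"
  shows "tree_word T v (w @ z) \<Longrightarrow> p u \<le> p v \<and> (z \<noteq> [] \<longrightarrow> p u < p v)"
proof (induction z arbitrary: v rule: rev_induct)
  case Nil
  then show ?case using u tree_word_inj by force
next
  case (snoc i z)
  then obtain v' where v': "v = Some i" "tree_word T v' (w @ z)" "(Some i, v') \<in> T"
    by (metis append_assoc tree_word_snocE)
  then have "p v' < p v" using p by (auto simp: is_tree_label_def)
  then show ?case using snoc.IH[OF v'(2)] by auto
qed

lemma tree_word_vertex: "tree_word T v w \<Longrightarrow> v \<in> cone_vertices n"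
  by (cases rule: tree_word.cases) (auto dest: functional_treeD(1)[OF T])

text \<open>If a vertex \<open>v\<close> in the subtree of \<open>a\<close> came after the sibling
  \<open>b\<close> while its parent \<open>v'\<close> came before, the edge from \<open>b\<close> to
  \<open>k\<close> and the edge from \<open>v\<close> to \<open>v'\<close> would cross. So the
  property passes down the subtree.\<close>

lemma is_tree_label_branch:
  assumes p: "is_tree_label n T p"
    and a: "(Some a, k) \<in> T" and b: "(Some b, k) \<in> T" and ba: "b < a" and w: "tree_word T k w"
  shows "tree_word T v (w @ a # z) \<Longrightarrow> p v < p (Some b)"
proof (induction z arbitrary: v rule: rev_induct)
  case Nil
  then have "v = Some a" by (rule tree_word_snocE)
  moreover have "\<And>i j k. (Some i, k) \<in> T \<and> (Some j, k) \<in> T \<and> i < j \<Longrightarrow> p (Some j) < p (Some i)"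
    using p unfolding is_tree_label_def by blast
  ultimately show ?case using a b ba by blast
next
  case (snoc c z)
  then obtain v' where v': "v = Some c" "tree_word T v' (w @ a # z)" "(Some c, v') \<in> T"
    by (metis append_assoc append_Cons tree_word_snocE)
  have "p k < p v'"
    using is_tree_label_ancestor[OF p w v'(2)] by simp
  moreover have "p v' < p (Some b)"
    using snoc.IH[OF v'(2)] .
  ultimately have "\<not> p (Some b) < p v"
    using p b v' unfolding is_tree_label_def by blast
  moreover have "p v \<noteq> p (Some b)"
  proof
    assume "p v = p (Some b)"
    moreover have "Some b \<in> cone_vertices n" "v \<in> cone_vertices n"
      using functional_treeD(1)[OF T b] tree_word_vertex[OF snoc.prems] .
    ultimately have "v = Some b"
      using p unfolding is_tree_label_def bij_betw_def by (meson inj_onD)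
    then have "w @ a # z @ [c] = w @ [b]"
      using tree_word_unique[OF T] snoc.prems tree_word.child[OF w b] by blast
    then show False by simp
  qed
  ultimately show ?case by simp
qed

text \<open>Prefixes are ancestors. At a branching, the subtree of \<open>a\<close> stays below
  \<open>Some b\<close>, which is \<open>v\<close> itself or an ancestor of it. Uniqueness follows,
  since a bijection onto \<open>{0..n}\<close> is determined by the order it induces.\<close>

lemma is_tree_label_mono:
  assumes p: "is_tree_label n T p" and u: "tree_word T u x" and v: "tree_word T v y"
    and xy: "(x, y) \<in> preorder"
  shows "p u < p v"
  using xy
proof (cases rule: preorderE)
  case (prefix i z)
  then show ?thesis using is_tree_label_ancestor[OF p u] v by simp
next
  case (branch w a b x' y')
  obtain u' where "tree_word T u' (w @ [a])"
    using u branch by (metis append_Cons append_Nil append_assoc tree_word_appendE)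
  then obtain k where k: "(Some a, k) \<in> T" "tree_word T k w"
    by (auto elim: tree_word_snocE)
  obtain v' where v': "tree_word T v' (w @ [b])"
    using v branch by (metis append_Cons append_Nil append_assoc tree_word_appendE)
  then obtain k' where k': "v' = Some b" "(Some b, k') \<in> T" "tree_word T k' w"
    by (auto elim: tree_word_snocE)
  have "k' = k" using tree_word_inj k k' by metis
  then have "p u < p (Some b)"
    using is_tree_label_branch[OF p k(1) _ branch(1) k(2)] k' u branch(2) by blast
  also have "\<dots> \<le> p v"
    using is_tree_label_ancestor[OF p v', of v y'] v branch(3) k'(1) by simp
  finally show ?thesis .
qed

lemma is_tree_label_unique:
  assumes p: "is_tree_label n T p"
  shows "p = restrict (rank_in (cone_vertices n) (word_of T)) (cone_vertices n)"
proof (rule extensionalityI[OF _ restrict_extensional])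
  let ?V = "cone_vertices n"
  show "p \<in> extensional ?V" using p by (simp add: is_tree_label_def)
  have bij: "bij_betw p ?V {0..n}" using p by (simp add: is_tree_label_def)
  fix v
  assume v: "v \<in> ?V"
  have "p u < p v \<longleftrightarrow> (word_of T u, word_of T v) \<in> preorder" if u: "u \<in> ?V" for u
  proof (cases "u = v")
    case False
    then have "word_of T u \<noteq> word_of T v"
      using inj_on_word_of[OF T] u v by (meson inj_onD)
    then show ?thesis
      using preorder_total is_tree_label_mono[OF p] tree_word_word_of[OF T u]
        tree_word_word_of[OF T v] by (metis order_less_asym)
  qed (simp add: preorder_irrefl)
  then have "rank_in ?V (word_of T) v = card {u \<in> ?V. p u < p v}"
    unfolding rank_in_def by (intro arg_cong[of _ _ card] Collect_cong) blast
  also have "\<dots> = card (p ` {u \<in> ?V. p u < p v})"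
    using bij by (intro card_image[symmetric]) (auto simp: bij_betw_def inj_on_def)
  \<comment> \<open>As \<open>p\<close> takes all values in \<open>{0..n}\<close>, every number
    below \<open>p v\<close> is a label, and the count gives back \<open>p v\<close>.\<close>
  also have "p ` {u \<in> ?V. p u < p v} = {..<p v}"
  proof
    show "{..<p v} \<subseteq> p ` {u \<in> ?V. p u < p v}"
    proof
      fix x
      assume x: "x \<in> {..<p v}"
      have "p v \<in> {0..n}" using bij v by (rule bij_betwE[THEN bspec])
      then have "x \<in> p ` ?V" using x bij by (simp add: bij_betw_def del: image_insert)
      then show "x \<in> p ` {u \<in> ?V. p u < p v}" using x by blast
    qed
  qed auto
  finally show "p v = restrict (rank_in ?V (word_of T)) ?V v"
    using v by simp
qed

lemma tree_label_eqI: "is_tree_label n T p \<Longrightarrow> tree_label n T = p"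
  unfolding tree_label_def by (rule the_equality) (metis is_tree_label_unique)+

lemma is_tree_label_tree_label: "is_tree_label n T (tree_label n T)"
  using is_tree_label_rank tree_label_eqI by metis

end

section \<open>Partitions and noncrossing partitions\<close>

lemma block_of_eq:
  assumes "partition_on A P" "B \<in> P" "x \<in> B"
  shows "block_of P x = B"
  unfolding block_of_def
proof (rule the_equality)
  fix B'
  assume "B' \<in> P \<and> x \<in> B'"
  then show "B' = B"
    using assms partition_onD2[OF assms(1)] by (auto simp: disjoint_def)
qed (use assms in simp)

lemma block_of_in:
  assumes "partition_on A P" "x \<in> A"
  shows "block_of P x \<in> P" "x \<in> block_of P x" "block_of P x \<subseteq> A"
proof -
  obtain B where "B \<in> P" "x \<in> B" using assms partition_onD1 by blast
  then show "block_of P x \<in> P" "x \<in> block_of P x" "block_of P x \<subseteq> A"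
    using block_of_eq[OF assms(1)] partition_onD1[OF assms(1)] by auto
qed

lemma block_of_eq_iff:
  assumes "partition_on A P" "x \<in> A"
  shows "y \<in> block_of P x \<longleftrightarrow> y \<in> A \<and> block_of P y = block_of P x"
proof
  assume y: "y \<in> block_of P x"
  then show "y \<in> A \<and> block_of P y = block_of P x"
    using block_of_in(3)[OF assms] block_of_eq[OF assms(1) block_of_in(1)[OF assms] y] by blast
next
  assume "y \<in> A \<and> block_of P y = block_of P x"
  then show "y \<in> block_of P x"
    using block_of_in(2)[OF assms(1), of y] by simp
qed

lemma partition_eq_image_block_of:
  assumes "partition_on A P"
  shows "P = block_of P ` A"
proof
  show "P \<subseteq> block_of P ` A"
  proof
    fix B
    assume B: "B \<in> P"
    then obtain x where "x \<in> B" using partition_onD3[OF assms] by (metis ex_in_conv)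
    then show "B \<in> block_of P ` A"
      using block_of_eq[OF assms B] partition_onD1[OF assms] B by blast
  qed
  show "block_of P ` A \<subseteq> P" using block_of_in[OF assms] by blast
qed

lemma partition_eqI:
  assumes "partition_on A P" "partition_on A Q" "\<And>x. x \<in> A \<Longrightarrow> block_of P x = block_of Q x"
  shows "P = Q"
proof -
  have "block_of P ` A = block_of Q ` A" using assms(3) by (rule image_cong[OF refl])
  then show ?thesis using partition_eq_image_block_of assms(1,2) by metis
qed

lemma refines_iff_block_of:
  assumes P: "partition_on A P" and Q: "partition_on A Q"
  shows "refines A P Q \<longleftrightarrow> (\<forall>x\<in>A. block_of P x \<subseteq> block_of Q x)"
proof
  assume ref: "refines A P Q"
  show "\<forall>x\<in>A. block_of P x \<subseteq> block_of Q x"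
  proof
    fix x
    assume x: "x \<in> A"
    obtain Y where "Y \<in> Q" "block_of P x \<subseteq> Y"
      using ref block_of_in(1)[OF P x] unfolding refines_def by blast
    then show "block_of P x \<subseteq> block_of Q x"
      using block_of_in(2)[OF P x] block_of_eq[OF Q] by blast
  qed
next
  assume sub: "\<forall>x\<in>A. block_of P x \<subseteq> block_of Q x"
  have "\<exists>Y\<in>Q. X \<subseteq> Y" if "X \<in> P" for X
  proof -
    have "X \<in> block_of P ` A"
      using equalityD1[OF partition_eq_image_block_of[OF P]] that by (rule subsetD)
    then obtain x where x: "x \<in> A" "X = block_of P x" by blast
    have "X \<subseteq> block_of Q x" using sub x by simp
    then show ?thesis using block_of_in(1)[OF Q x(1)] by (rule bexI)
  qed
  then show "refines A P Q" using P Q by (simp add: refines_def)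
qed

lemma refines_block_of:
  assumes "refines A P Q" "x \<in> A"
  shows "block_of P x \<subseteq> block_of Q x"
proof -
  have "partition_on A P" "partition_on A Q" using assms(1) by (simp_all add: refines_def)
  from refines_iff_block_of[OF this] assms show ?thesis by simp
qed

text \<open>Sending a block of \<open>P\<close> to the block of \<open>Q\<close> around it is a
  surjection; equally many blocks make it injective, and then no block of \<open>Q\<close> contains
  two blocks of \<open>P\<close>.\<close>

lemma refines_card_le:
  assumes "finite A" "refines A P Q"
  shows "card Q \<le> card P" and "card P = card Q \<Longrightarrow> P = Q"
proof -
  have P: "partition_on A P" and Q: "partition_on A Q"
    using assms(2) by (auto simp: refines_def)
  have fin: "finite P" "finite Q" using finite_elements assms(1) P Q by blast+
  \<comment> \<open>The chosen element is immaterial: all elements of a block of \<open>P\<close>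
    lie in one block of \<open>Q\<close>.\<close>
  define f where "f B = block_of Q (SOME x. x \<in> B)" for B
  have f: "f (block_of P x) = block_of Q x" if x: "x \<in> A" for x
  proof -
    have "(SOME y. y \<in> block_of P x) \<in> block_of P x"
      using block_of_in(2)[OF P x] by (rule someI)
    then have "(SOME y. y \<in> block_of P x) \<in> block_of Q x"
      using refines_block_of[OF assms(2) x] by blast
    then show ?thesis unfolding f_def using block_of_eq_iff[OF Q x] by blast
  qed
  have img: "f ` P = Q"
  proof -
    have "f ` P = f ` block_of P ` A" using partition_eq_image_block_of[OF P] by simp
    also have "\<dots> = block_of Q ` A" unfolding image_image by (rule image_cong) (auto simp: f)
    finally show ?thesis using partition_eq_image_block_of[OF Q] by simp
  qed
  then show "card Q \<le> card P" using fin card_image_le by blast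
  assume "card P = card Q"
  then have inj: "inj_on f P" using fin img by (intro eq_card_imp_inj_on) auto
  show "P = Q"
  proof (rule partition_eqI[OF P Q])
    fix x
    assume x: "x \<in> A"
    have "block_of Q x \<subseteq> block_of P x"
    proof
      fix y
      assume "y \<in> block_of Q x"
      then have y: "y \<in> A" "block_of Q y = block_of Q x" using block_of_eq_iff[OF Q x] by auto
      then have "block_of P y = block_of P x"
        using inj_onD[OF inj] f x block_of_in(1)[OF P] by metis
      then show "y \<in> block_of P x" using block_of_in(2)[OF P y(1)] by simp
    qed
    then show "block_of P x = block_of Q x" using refines_block_of[OF assms(2) x] by simp
  qed
qed

lemma
  assumes P: "partition_on A P" and x: "x \<in> A" and y: "y \<in> A"
  shows partition_on_merge_blocks: "partition_on A (merge_blocks P x y)"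
    and block_of_merge_blocks: "\<And>z. z \<in> A \<Longrightarrow> block_of (merge_blocks P x y) z =
      (if block_of P z = block_of P x \<or> block_of P z = block_of P y
       then block_of P x \<union> block_of P y else block_of P z)"
proof -
  let ?X = "block_of P x" and ?Y = "block_of P y"
  have X: "?X \<in> P" "?Y \<in> P" using block_of_in[OF P] x y by auto
  have disj: "B \<inter> B' = {}" if "B \<in> P" "B' \<in> P" "B \<noteq> B'" for B B'
    using partition_onD2[OF P] that by (auto simp: disjoint_def)
  show part: "partition_on A (merge_blocks P x y)"
  proof (rule partition_onI)
    show "\<Union> (merge_blocks P x y) = A"
      using X partition_onD1[OF P] by (auto simp: merge_blocks_def)
    show "disjnt p q" if "p \<in> merge_blocks P x y" "q \<in> merge_blocks P x y" "p \<noteq> q" for p q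
      using that X disj unfolding merge_blocks_def disjnt_def by blast
    show "{} \<notin> merge_blocks P x y"
      using X partition_onD3[OF P] by (auto simp: merge_blocks_def)
  qed
  fix z
  assume z: "z \<in> A"
  show "block_of (merge_blocks P x y) z =
      (if block_of P z = ?X \<or> block_of P z = ?Y then ?X \<union> ?Y else block_of P z)"
    using block_of_in[OF P z] by (intro block_of_eq[OF part]) (auto simp: merge_blocks_def)
qed

lemma refines_merge_blocks:
  assumes P: "partition_on A P" and x: "x \<in> A" and y: "y \<in> A"
  shows "refines A P (merge_blocks P x y)"
  unfolding refines_iff_block_of[OF P partition_on_merge_blocks[OF assms]]
  using block_of_merge_blocks[OF assms] by auto

lemma card_merge_blocks:
  assumes P: "partition_on A P" and x: "x \<in> A" and y: "y \<in> A"
    and "finite A" and ne: "block_of P x \<noteq> block_of P y"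
  shows "Suc (card (merge_blocks P x y)) = card P"
proof -
  let ?X = "block_of P x" and ?Y = "block_of P y"
  have fin: "finite P" using finite_elements assms by blast
  have X: "?X \<in> P" "?Y \<in> P" "x \<in> ?X" "y \<in> ?Y" using block_of_in[OF P] x y by auto
  have "?X \<union> ?Y \<notin> P"
    using block_of_eq[OF P, of "?X \<union> ?Y" x] block_of_eq[OF P, of "?X \<union> ?Y" y] X ne by auto
  then have "card (merge_blocks P x y) = Suc (card (P - {?X, ?Y}))"
    unfolding merge_blocks_def using fin by simp
  also have "card (P - {?X, ?Y}) = card P - 2"
    using X ne fin by (subst card_Diff_subset) auto
  finally have "card (merge_blocks P x y) = Suc (card P - 2)" .
  moreover have "card {?X, ?Y} \<le> card P" using X fin by (intro card_mono) auto
  ultimately show ?thesis using ne by simp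
qed

lemma refines_merge_blocks_le:
  assumes ref: "refines A P Q" and x: "x \<in> A" and y: "y \<in> block_of Q x"
  shows "refines A (merge_blocks P x y) Q"
proof -
  have P: "partition_on A P" and Q: "partition_on A Q" using ref by (auto simp: refines_def)
  have y': "y \<in> A" "block_of Q y = block_of Q x" using y block_of_eq_iff[OF Q x] by auto
  have "block_of (merge_blocks P x y) z \<subseteq> block_of Q z" if z: "z \<in> A" for z
  proof (cases "block_of P z = block_of P x \<or> block_of P z = block_of P y")
    case True
    then have "z \<in> block_of P x \<or> z \<in> block_of P y" using block_of_in(2)[OF P z] by auto
    then have "z \<in> block_of Q x"
      using refines_block_of[OF ref] x y' by blast
    then have "block_of Q z = block_of Q x" using block_of_eq_iff[OF Q x] by simp
    moreover have "block_of (merge_blocks P x y) z = block_of P x \<union> block_of P y"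
      using True block_of_merge_blocks[OF P x y'(1) z] by simp
    moreover have "block_of P x \<subseteq> block_of Q x" "block_of P y \<subseteq> block_of Q x"
      using refines_block_of[OF ref x] refines_block_of[OF ref y'(1)] y'(2) by simp_all
    ultimately show ?thesis by simp
  next
    case False
    then show ?thesis
      using block_of_merge_blocks[OF P x y'(1) z] refines_block_of[OF ref z] by simp
  qed
  then show ?thesis
    using refines_iff_block_of[OF partition_on_merge_blocks[OF P x y'(1)] Q] by blast
qed

section \<open>Noncrossing partitions and a merge that fits between two of them\<close>

lemma noncrossing_iff_block_of:
  assumes P: "partition_on {0..n} P"
  shows "noncrossing P \<longleftrightarrow> (\<forall>a b c d. a < b \<and> b < c \<and> c < d \<and> d \<le> n \<and>
      block_of P c = block_of P a \<and> block_of P d = block_of P b \<longrightarrow> block_of P a = block_of P b)"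
    (is "_ \<longleftrightarrow> ?R")
proof
  assume nc: "noncrossing P"
  show ?R
  proof (intro allI impI)
    fix a b c d
    assume *: "a < b \<and> b < c \<and> c < d \<and> d \<le> n \<and>
      block_of P c = block_of P a \<and> block_of P d = block_of P b"
    then have "block_of P a \<in> P" "block_of P b \<in> P" "a \<in> block_of P a" "c \<in> block_of P a"
      "b \<in> block_of P b" "d \<in> block_of P b"
      using block_of_in[OF P, of a] block_of_in[OF P, of b] block_of_in[OF P, of c]
        block_of_in[OF P, of d] by auto
    then show "block_of P a = block_of P b"
      using nc * unfolding noncrossing_def by blast
  qed
next
  assume R: ?R
  show "noncrossing P"
    unfolding noncrossing_def
  proof clarify
    fix i j k l B B'
    assume *: "B \<in> P" "B' \<in> P" "i < j" "j < k" "k < l" "B \<noteq> B'" "i \<in> B" "k \<in> B" "j \<in> B'" "l \<in> B'"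
    then have "block_of P i = B" "block_of P k = B" "block_of P j = B'" "block_of P l = B'" "l \<le> n"
      using block_of_eq[OF P] partition_onD1[OF P] by auto
    then show False using R * by blast
  qed
qed

lemma NC_partition: "P \<in> NC n \<Longrightarrow> partition_on {0..n} P"
  by (simp add: NC_def)

lemma NC_noncrossing:
  assumes "P \<in> NC n" "a < b" "b < c" "c < d" "d \<le> n"
    "block_of P c = block_of P a" "block_of P d = block_of P b"
  shows "block_of P a = block_of P b"
  using assms noncrossing_iff_block_of[of n P] unfolding NC_def by blast

text \<open>In a step of a maximal chain \<open>x\<close> and \<open>y\<close> turn out to be its \<^const>\<open>upper\<close> and
  \<^const>\<open>lower\<close> elements.\<close>

definition merge_step :: "nat \<Rightarrow> nat set set \<Rightarrow> nat set set \<Rightarrow> nat \<Rightarrow> nat \<Rightarrow> bool" where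
  "merge_step n P Q x y \<longleftrightarrow>
     y < x \<and> x \<le> n \<and> (\<forall>z\<in>block_of P x. x \<le> z) \<and> block_of P x \<noteq> block_of P y \<and>
     Q = merge_blocks P x y \<and> (\<forall>z\<in>block_of Q x. z < x \<longrightarrow> z \<le> y)"

text \<open>In a block \<open>D\<close> of \<open>Q\<close> that \<open>P\<close> splits, let
  \<open>B\<close> be the \<open>P\<close>-block of the minimum, \<open>x\<close> the least element
  of \<open>D\<close> outside \<open>B\<close>, and \<open>y\<close> the element of \<open>D\<close>
  just before \<open>x\<close>. All elements of \<open>D\<close> up to \<open>y\<close> are in
  \<open>B\<close>, so every further \<open>P\<close>-block inside \<open>D\<close> begins after
  \<open>x\<close>. This choice keeps the merge noncrossing.\<close>

lemma NC_interpolation: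
  assumes P: "P \<in> NC n" and Q: "Q \<in> NC n" and ref: "refines {0..n} P Q" and ne: "P \<noteq> Q"
  obtains x y where "merge_step n P (merge_blocks P x y) x y"
    "merge_blocks P x y \<in> NC n" "refines {0..n} (merge_blocks P x y) Q"
proof -
  note Pp = NC_partition[OF P] and Qp = NC_partition[OF Q]
  obtain a where a: "a \<in> {0..n}" "block_of P a \<noteq> block_of Q a"
    using partition_eqI[OF Pp Qp] ne by blast
  define D where "D = block_of Q a"
  have D: "D \<subseteq> {0..n}" "a \<in> D" "finite D"
    using block_of_in[OF Qp a(1)] finite_subset by (auto simp: D_def)
  have Dq: "z \<in> D \<longleftrightarrow> z \<in> {0..n} \<and> block_of Q z = D" for z
    unfolding D_def by (rule block_of_eq_iff[OF Qp a(1)])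
  have sub_D: "block_of P z \<subseteq> D" if "z \<in> D" for z
    using refines_block_of[OF ref, of z] that Dq by auto
  define m where "m = Min D"
  have m: "m \<in> D" "\<And>z. z \<in> D \<Longrightarrow> m \<le> z"
    unfolding m_def using Min_in[OF D(3)] Min_le[OF D(3)] D(2) by blast+
  define B where "B = block_of P m"
  have mn: "m \<in> {0..n}" using m D by blast
  have B: "B \<subseteq> D" "m \<in> B" using sub_D[OF m(1)] block_of_in(2)[OF Pp mn] by (auto simp: B_def)
  have Bq: "z \<in> B \<longleftrightarrow> z \<in> {0..n} \<and> block_of P z = B" for z
    unfolding B_def by (rule block_of_eq_iff[OF Pp mn])
  have "B \<noteq> D" using a D Bq unfolding D_def by metis
  then have DB: "D - B \<noteq> {}" using B by blast
  define x where "x = Min (D - B)"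
  have x: "x \<in> D" "x \<notin> B" "\<And>z. z \<in> D \<Longrightarrow> z < x \<Longrightarrow> z \<in> B"
    using Min_in[of "D - B"] Min_le[of "D - B"] D(3) DB by (force simp: x_def)+
  have mx: "m < x" using m(2)[OF x(1)] x(2) B(2) by (metis le_neq_implies_less)
  define y where "y = Max {z \<in> D. z < x}"
  have "y \<in> {z \<in> D. z < x}"
    unfolding y_def using m mx D(3) by (intro Max_in) auto
  then have y: "y \<in> D" "y < x" "y \<in> B" using x by auto
  have ymax: "z \<le> y" if "z \<in> D" "z < x" for z
    unfolding y_def using D(3) that by (intro Max_ge) auto
  have xn: "x \<in> {0..n}" and yn: "y \<in> {0..n}" using x y D by auto
  define B' where "B' = block_of P x"
  have B'q: "z \<in> B' \<longleftrightarrow> z \<in> {0..n} \<and> block_of P z = B'" for z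
    unfolding B'_def by (rule block_of_eq_iff[OF Pp xn])
  have Py: "block_of P y = B" using y Bq by blast
  have BB': "B' \<noteq> B" using x(2) Bq xn unfolding B'_def by metis
  have B'D: "B' \<subseteq> D" "x \<in> B'" using sub_D[OF x(1)] block_of_in(2)[OF Pp xn] by (auto simp: B'_def)
  let ?M = "merge_blocks P x y"
  note Mp = partition_on_merge_blocks[OF Pp xn yn]
  have Mb: "block_of ?M z = (if block_of P z = B' \<or> block_of P z = B then B' \<union> B else block_of P z)"
    if "z \<in> {0..n}" for z
    using block_of_merge_blocks[OF Pp xn yn that] Py by (simp add: B'_def)
  \<comment> \<open>A third block inside \<open>D\<close> lies after both \<open>y\<close> and
    \<open>x\<close>. An element of \<open>B\<close> or \<open>B'\<close> between two of its
    elements would make it cross \<open>B\<close> or \<open>B'\<close> already in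
    \<open>P\<close>.\<close>
  have key: False
    if lt: "e < b" "b < e'" "e' \<le> n" and ee: "block_of P e' = block_of P e" and e: "e \<in> D"
      and eB: "block_of P e \<noteq> B" "block_of P e \<noteq> B'" and b: "block_of P b = B \<or> block_of P b = B'"
    for e b e'
  proof -
    have en: "e \<in> {0..n}" using e D by blast
    have "e \<noteq> x" using eB by (auto simp: B'_def)
    moreover have "e \<notin> B" using eB Bq by blast
    ultimately have xe: "x < e" using x(3)[OF e] by (metis linorder_neqE_nat)
    from b show False
    proof
      assume "block_of P b = B"
      then show False
        using NC_noncrossing[OF P, of y e b e'] lt xe y Py ee eB by simp
    next
      assume "block_of P b = B'"
      then show False
        using NC_noncrossing[OF P, of x e b e'] lt xe ee eB by (simp add: B'_def)
    qed
  qed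
  have block_M_D: "z \<in> D" if "z \<in> {0..n}" "block_of P z = B \<or> block_of P z = B'" for z
    using that Bq B'q B B'D by blast
  have "noncrossing ?M"
    unfolding noncrossing_iff_block_of[OF Mp]
  proof (intro allI impI, elim conjE, rule ccontr)
    fix a b c d
    assume lt: "a < b" "b < c" "c < d" "d \<le> n"
      and eq: "block_of ?M c = block_of ?M a" "block_of ?M d = block_of ?M b"
      and ne: "block_of ?M a \<noteq> block_of ?M b"
    have range: "a \<in> {0..n}" "b \<in> {0..n}" "c \<in> {0..n}" "d \<in> {0..n}" using lt by auto
    have Pdiff: "block_of P a \<noteq> block_of P b"
    proof
      assume "block_of P a = block_of P b"
      then have "block_of ?M a = block_of ?M b"
        by (simp only: Mb[OF range(1)] Mb[OF range(2)])
      then show False using ne by blast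
    qed
    have merged_iff: "block_of ?M z = B' \<union> B \<longleftrightarrow> block_of P z = B' \<or> block_of P z = B" if z: "z \<in> {0..n}" for z
    proof
      assume "block_of ?M z = B' \<union> B"
      then have "z \<in> B' \<union> B" using block_of_in(2)[OF Mp z] by simp
      then show "block_of P z = B' \<or> block_of P z = B" using Bq B'q by blast
    qed (use Mb[OF z] in simp)
    have same: "block_of P z = block_of P w"
      if "z \<in> {0..n}" "w \<in> {0..n}" "block_of ?M z = block_of ?M w" "block_of ?M z \<noteq> B' \<union> B" for z w
      using that merged_iff[of z] merged_iff[of w] Mb by simp
    have Q_same: "block_of Q z = block_of Q w"
      if "z \<in> {0..n}" "w \<in> {0..n}" "block_of ?M z = block_of ?M w" for z w
    proof -
      have "z \<in> block_of ?M w" using that block_of_eq_iff[OF Mp] by blast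
      then have "z \<in> block_of Q w"
        using refines_block_of[OF refines_merge_blocks_le[OF ref xn] that(2)] y(1) x(1) Dq by blast
      then show ?thesis using block_of_eq_iff[OF Qp that(2)] by blast
    qed
    \<comment> \<open>A crossing in the merged partition is confined to a single block of
      \<open>Q\<close>. So if one of the two blocks is the merged one, the other lies in
      \<open>D\<close> too and \<open>key\<close> applies; otherwise the crossing was in
      \<open>P\<close>.\<close>
    have Qab: "block_of Q a = block_of Q b"
      using NC_noncrossing[OF Q lt] Q_same range eq by blast
    show False
    proof (cases "block_of ?M a = B' \<union> B")
      case True
      then have nb: "block_of ?M b \<noteq> B' \<union> B" using ne by simp
      have "a \<in> D" using True merged_iff block_M_D range by blast
      then have "b \<in> D" using Qab Dq range by metis
      moreover have "block_of P c = B \<or> block_of P c = B'"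
        using True eq merged_iff range by metis
      moreover have "block_of P d = block_of P b"
        using same[of d b] eq nb range by simp
      moreover have "block_of P b \<noteq> B" "block_of P b \<noteq> B'"
        using nb merged_iff range by blast+
      ultimately show False
        using key[of b c d] lt by blast
    next
      case na: False
      have ac: "block_of P c = block_of P a"
        using same[of c a] eq na range by simp
      show False
      proof (cases "block_of ?M b = B' \<union> B")
        case True
        have "b \<in> D" using True merged_iff block_M_D range by blast
        then have "a \<in> D" using Qab Dq range by metis
        moreover have "block_of P b = B \<or> block_of P b = B'"
          using True merged_iff range by metis
        moreover have "block_of P a \<noteq> B" "block_of P a \<noteq> B'"
          using na merged_iff range by blast+
        ultimately show False
          using key[of a b c] lt ac by simp
      next
        case False
        then have "block_of P d = block_of P b"
          using same[of d b] eq range by simp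
        then show False
          using NC_noncrossing[OF P lt ac] Pdiff by blast
      qed
    qed
  qed
  then have M_NC: "?M \<in> NC n" using Mp by (simp add: NC_def)
  have "z \<le> y" if "z \<in> block_of ?M x" "z < x" for z
  proof -
    have "block_of ?M x = B' \<union> B" using Mb[OF xn] by (simp add: B'_def)
    then show ?thesis using that B B'D ymax by blast
  qed
  moreover have "\<forall>z\<in>block_of P x. x \<le> z"
  proof
    fix z
    assume "z \<in> block_of P x"
    then have "z \<in> D" "z \<notin> B" using B'D BB' Bq B'q unfolding B'_def by blast+
    then show "x \<le> z" using x(3) by (meson not_le)
  qed
  ultimately have "merge_step n P ?M x y"
    unfolding merge_step_def using y xn BB' Py by (auto simp: B'_def)
  moreover have "refines {0..n} ?M Q"
    using refines_merge_blocks_le[OF ref xn] y(1) x(1) Dq by blast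
  ultimately show thesis using that M_NC by blast
qed

section \<open>Maximal chains of noncrossing partitions\<close>

lemma merge_step_lower:
  assumes P: "partition_on {0..n} P" and step: "merge_step n P Q x y"
  shows "Max {z \<in> block_of Q x. z < x} = y"
proof (rule Max_eqI)
  have xy: "x \<in> {0..n}" "y \<in> {0..n}" and Q: "Q = merge_blocks P x y"
    using step by (auto simp: merge_step_def)
  have Qx: "block_of Q x = block_of P x \<union> block_of P y"
    using block_of_merge_blocks[OF P xy xy(1)] Q by simp
  have "block_of Q x \<subseteq> {0..n}"
    unfolding Qx using block_of_in(3)[OF P] xy by blast
  then show "finite {z \<in> block_of Q x. z < x}" by simp
  show "y \<in> {z \<in> block_of Q x. z < x}"
    using Qx block_of_in(2)[OF P xy(2)] step by (simp add: merge_step_def)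
  show "z \<le> y" if "z \<in> {z \<in> block_of Q x. z < x}" for z
    using that step by (simp add: merge_step_def)
qed

lemma Min_block_of_eq_iff:
  fixes n :: nat
  assumes P: "partition_on {0..n} P" and x: "x \<in> {0..n}"
  shows "x = Min (block_of P x) \<longleftrightarrow> (\<forall>z\<in>block_of P x. x \<le> z)"
proof -
  have fin: "finite (block_of P x)" using finite_subset[OF block_of_in(3)[OF P x]] by simp
  moreover have "block_of P x \<noteq> {}" using block_of_in(2)[OF P x] by blast
  ultimately have "Min (block_of P x) = x \<longleftrightarrow> x \<in> block_of P x \<and> (\<forall>z\<in>block_of P x. x \<le> z)"
    by (rule Min_eq_iff)
  then show ?thesis
    using block_of_in(2)[OF P x] by (simp add: eq_commute[of x])
qed

text \<open>Only the two merged blocks can lose a minimum. That of the block of \<open>y\<close> is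
  at most \<open>y\<close>, hence below all of the block of \<open>x\<close>, and survives.\<close>

lemma merge_step_upper:
  assumes P: "partition_on {0..n} P" and step: "merge_step n P Q x y"
  shows "(THE z. z \<in> {0..n} \<and> z = Min (block_of P z) \<and> z \<noteq> Min (block_of Q z)) = x"
proof (rule the_equality)
  have xy: "x \<in> {0..n}" "y \<in> {0..n}" "y < x" and Q: "Q = merge_blocks P x y"
    and x_min: "\<And>z. z \<in> block_of P x \<Longrightarrow> x \<le> z"
    using step by (auto simp: merge_step_def)
  note Qp = partition_on_merge_blocks[OF P xy(1,2), folded Q]
  have Qz: "block_of Q z = (if block_of P z = block_of P x \<or> block_of P z = block_of P y
      then block_of P x \<union> block_of P y else block_of P z)" if "z \<in> {0..n}" for z
    using block_of_merge_blocks[OF P xy(1,2) that] Q by simp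
  have "y \<in> block_of Q x" using Qz[OF xy(1)] block_of_in(2)[OF P xy(2)] by simp
  then have "x \<noteq> Min (block_of Q x)"
    using Min_block_of_eq_iff[OF Qp xy(1)] xy(3) by force
  then show "x \<in> {0..n} \<and> x = Min (block_of P x) \<and> x \<noteq> Min (block_of Q x)"
    using Min_block_of_eq_iff[OF P xy(1)] xy x_min by simp
  fix z
  assume "z \<in> {0..n} \<and> z = Min (block_of P z) \<and> z \<noteq> Min (block_of Q z)"
  then have z: "z \<in> {0..n}" "\<And>w. w \<in> block_of P z \<Longrightarrow> z \<le> w" "\<not> (\<forall>w\<in>block_of Q z. z \<le> w)"
    using Min_block_of_eq_iff[OF P, of z] Min_block_of_eq_iff[OF Qp, of z] by auto
  have xz: "x \<in> block_of P x" "z \<in> block_of P z" "y \<in> block_of P y"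
    using block_of_in(2)[OF P] xy z by auto
  have "block_of Q z \<noteq> block_of P z" using z(2,3) by auto
  then have union: "block_of Q z = block_of P x \<union> block_of P y"
    and "block_of P z = block_of P x \<or> block_of P z = block_of P y"
    using Qz[OF z(1)] by (auto split: if_splits)
  then show "z = x"
  proof (elim disjE)
    assume "block_of P z = block_of P x"
    then show ?thesis using x_min z(2) xz by (metis le_antisym)
  next
    assume eq: "block_of P z = block_of P y"
    then have "z < x" using z(2) xz xy(3) by fastforce
    then have "\<forall>w\<in>block_of Q z. z \<le> w"
      using union eq z(2) x_min by fastforce
    then show ?thesis using z(3) by blast
  qed
qed

text \<open>A chain indexed by rank, the rank being \<open>Suc n\<close> minus the number of blocks.
  Prescribing block counts says that no rank is skipped, without mentioning covers; values beyond
  \<open>n\<close> are free.\<close>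

definition saturated :: "nat \<Rightarrow> (nat \<Rightarrow> nat set set) \<Rightarrow> bool" where
  "saturated n \<pi> \<longleftrightarrow>
     (\<forall>i\<le>n. \<pi> i \<in> NC n \<and> card (\<pi> i) + i = Suc n) \<and>
     (\<forall>i\<le>n. \<forall>j\<le>n. i \<le> j \<longrightarrow> refines {0..n} (\<pi> i) (\<pi> j))"

lemma saturatedD:
  assumes "saturated n \<pi>"
  shows "i \<le> n \<Longrightarrow> \<pi> i \<in> NC n" "i \<le> n \<Longrightarrow> card (\<pi> i) + i = Suc n"
    "i \<le> j \<Longrightarrow> j \<le> n \<Longrightarrow> refines {0..n} (\<pi> i) (\<pi> j)"
  using assms by (auto simp: saturated_def)

lemma saturated_inj:
  assumes "saturated n \<pi>" "i \<le> n" "j \<le> n" "\<pi> i = \<pi> j"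
  shows "i = j"
  using saturatedD(2)[OF assms(1)] assms by (metis add_left_cancel)

text \<open>The members strictly below \<open>\<pi> i\<close> are the \<open>i\<close> earlier ones,
  distinct because their block counts are.\<close>

lemma chain_elem_saturated:
  assumes sat: "saturated n \<pi>" and i: "i \<le> n"
  shows "chain_elem n (\<pi> ` {0..n}) i = \<pi> i"
proof -
  have card: "card {Q \<in> \<pi> ` {0..n}. refines {0..n} Q (\<pi> j) \<and> Q \<noteq> \<pi> j} = j" if j: "j \<le> n" for j
  proof -
    have "{Q \<in> \<pi> ` {0..n}. refines {0..n} Q (\<pi> j) \<and> Q \<noteq> \<pi> j} = \<pi> ` {..<j}"
    proof (intro set_eqI iffI)
      fix Q
      assume "Q \<in> {Q \<in> \<pi> ` {0..n}. refines {0..n} Q (\<pi> j) \<and> Q \<noteq> \<pi> j}"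
      then have img: "Q \<in> \<pi> ` {0..n}" and Q: "refines {0..n} Q (\<pi> j)" "Q \<noteq> \<pi> j" by blast+
      from img obtain k where "k \<le> n" "Q = \<pi> k" by auto
      with Q have k: "k \<le> n" "Q = \<pi> k" "refines {0..n} (\<pi> k) (\<pi> j)" "\<pi> k \<noteq> \<pi> j" by simp_all
      have "\<not> j \<le> k"
        using saturatedD(3)[OF sat, of j k] k refines_asym by metis
      then show "Q \<in> \<pi> ` {..<j}" using k by simp
    next
      fix Q
      assume "Q \<in> \<pi> ` {..<j}"
      then obtain k where k: "k < j" "Q = \<pi> k" by auto
      then have "\<pi> k \<noteq> \<pi> j" using saturated_inj[OF sat, of k j] j by auto
      then show "Q \<in> {Q \<in> \<pi> ` {0..n}. refines {0..n} Q (\<pi> j) \<and> Q \<noteq> \<pi> j}"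
        using saturatedD(3)[OF sat, of k j] k j by simp
    qed
    moreover have "inj_on \<pi> {..<j}"
      using saturated_inj[OF sat] j by (auto simp: inj_on_def)
    ultimately show ?thesis by (simp add: card_image)
  qed
  show ?thesis
    unfolding chain_elem_def
  proof (rule the_equality)
    show "\<pi> i \<in> \<pi> ` {0..n} \<and> card {Q \<in> \<pi> ` {0..n}. refines {0..n} Q (\<pi> i) \<and> Q \<noteq> \<pi> i} = i"
      using card[OF i] i by simp
    fix P
    assume P: "P \<in> \<pi> ` {0..n} \<and> card {Q \<in> \<pi> ` {0..n}. refines {0..n} Q P \<and> Q \<noteq> P} = i"
    then obtain j where j: "j \<le> n" "P = \<pi> j" by auto
    have "j = i" using P card[OF j(1)] unfolding j(2) by simp
    then show "P = \<pi> i" using j by simp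
  qed
qed

lemma NC_card_bounds:
  assumes "P \<in> NC n"
  shows "1 \<le> card P" "card P \<le> Suc n"
proof -
  note P = NC_partition[OF assms]
  have "finite P" using finite_elements[OF _ P] by simp
  moreover have "P \<noteq> {}" using partition_onD1[OF P] by fastforce
  ultimately show "1 \<le> card P" by (simp add: Suc_le_eq card_gt_0_iff)
  have "card (block_of P ` {0..n}) \<le> card {0..n}" by (rule card_image_le) simp
  then show "card P \<le> Suc n" by (subst partition_eq_image_block_of[OF P]) simp
qed

text \<open>A partition comparable to all members has as many blocks as one of them, and comparable
  partitions with equally many blocks are equal.\<close>

lemma saturated_in_max_chains:
  assumes sat: "saturated n \<pi>"
  shows "\<pi> ` {0..n} \<in> max_chains n"
proof -
  interpret pred_on "NC n" "refines {0..n}" .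
  have chain: "chain (\<pi> ` {0..n})"
  proof (rule chainI)
    show "\<pi> ` {0..n} \<subseteq> NC n" using saturatedD(1)[OF sat] by auto
    fix P Q
    assume "P \<in> \<pi> ` {0..n}" "Q \<in> \<pi> ` {0..n}"
    then obtain i j where "i \<le> n" "j \<le> n" "P = \<pi> i" "Q = \<pi> j" by auto
    then show "(refines {0..n})\<^sup>=\<^sup>= P Q \<or> (refines {0..n})\<^sup>=\<^sup>= Q P"
      using saturatedD(3)[OF sat] by (cases "i \<le> j") auto
  qed
  have "S \<subseteq> \<pi> ` {0..n}" if S: "chain S" "\<pi> ` {0..n} \<subseteq> S" for S
  proof
    fix X
    assume X: "X \<in> S"
    then have XN: "X \<in> NC n" using S(1) unfolding chain_def by blast
    define i where "i = Suc n - card X"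
    have i: "i \<le> n" "card X + i = Suc n" using NC_card_bounds[OF XN] by (auto simp: i_def)
    then have card: "card X = card (\<pi> i)" using saturatedD(2)[OF sat i(1)] by simp
    have "\<pi> i \<in> S" using S(2) i by auto
    then have "refines {0..n} X (\<pi> i) \<or> refines {0..n} (\<pi> i) X \<or> X = \<pi> i"
      using chain_total[OF S(1) X] by auto
    then have "X = \<pi> i"
      using refines_card_le(2)[of "{0..n}"] card by (metis finite_atLeastAtMost)
    then show "X \<in> \<pi> ` {0..n}" using i by simp
  qed
  then have "maxchain (\<pi> ` {0..n})"
    unfolding maxchain_def using chain by blast
  then show ?thesis by (simp add: max_chains_def)
qed

lemma singletons_NC: "(\<lambda>x. {x}) ` {0..n} \<in> NC n"
proof -
  have "noncrossing ((\<lambda>x. {x}) ` {0..n})" by (auto simp: noncrossing_def)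
  then show ?thesis by (simp add: NC_def partition_on_singletons)
qed

text \<open>No rank can be missing: a single merge fits between a member and the next one, is
  comparable to the whole chain, and belongs to it by maximality.\<close>

lemma max_chain_saturated:
  assumes C: "C \<in> max_chains n"
  obtains \<pi> where "saturated n \<pi>" "C = \<pi> ` {0..n}"
proof -
  interpret pred_on "NC n" "refines {0..n}" .
  have mc: "maxchain C" using C by (simp add: max_chains_def)
  then have ch: "chain C" by (simp add: maxchain_def)
  have C_NC: "P \<in> NC n" if "P \<in> C" for P using ch that unfolding chain_def by blast
  have total: "refines {0..n} P Q \<or> refines {0..n} Q P" if "P \<in> C" "Q \<in> C" for P Q
    using chain_total[OF ch that] refines_refl NC_partition C_NC that by (metis sup2E)
  have maximal: "X \<in> C" if X: "X \<in> NC n" "\<And>P. P \<in> C \<Longrightarrow> refines {0..n} P X \<or> refines {0..n} X P" for X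
  proof (rule ccontr)
    assume "X \<notin> C"
    moreover have "chain (insert X C)"
    proof (rule chainI)
      show "insert X C \<subseteq> NC n" using X C_NC by blast
      show "(refines {0..n})\<^sup>=\<^sup>= P Q \<or> (refines {0..n})\<^sup>=\<^sup>= Q P" if "P \<in> insert X C" "Q \<in> insert X C" for P Q
        using that X(2) total by auto
    qed
    ultimately show False using mc unfolding maxchain_def by blast
  qed
  have card_eq: "P = Q" if "P \<in> C" "Q \<in> C" "card P = card Q" for P Q
    using total[OF that(1,2)] refines_card_le(2)[of "{0..n}"] that(3) by (metis finite_atLeastAtMost)
  have card_less: "refines {0..n} P Q" if "P \<in> C" "Q \<in> C" "card Q \<le> card P" for P Q
  proof (cases "P = Q")
    case False
    then show ?thesis
      using total[OF that(1,2)] refines_card_le(1)[of "{0..n}" Q P] card_eq[OF that(1,2)] that(3)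
      by (metis finite_atLeastAtMost le_antisym)
  qed (use refines_refl NC_partition C_NC that in metis)
  have bottom: "(\<lambda>x. {x}) ` {0..n} \<in> C"
  proof (rule maximal[OF singletons_NC])
    fix P
    assume "P \<in> C"
    then have P: "partition_on {0..n} P" using C_NC NC_partition by blast
    have "refines {0..n} ((\<lambda>x. {x}) ` {0..n}) P"
      unfolding refines_def using P partition_on_singletons partition_onD1[OF P] by auto
    then show "refines {0..n} P ((\<lambda>x. {x}) ` {0..n}) \<or> refines {0..n} ((\<lambda>x. {x}) ` {0..n}) P" ..
  qed
  have top_partition: "partition_on {0..n} {{0..n}}" by (rule partition_on_space) simp
  have top: "{{0..n}} \<in> C"
  proof (rule maximal)
    show "{{0..n}} \<in> NC n" 
      using top_partition by (auto simp: NC_def noncrossing_def)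
    fix P
    assume "P \<in> C"
    then have P: "partition_on {0..n} P" using C_NC NC_partition by blast
    have "refines {0..n} P {{0..n}}"
      unfolding refines_def using P top_partition partition_onD1[OF P] by blast
    then show "refines {0..n} P {{0..n}} \<or> refines {0..n} {{0..n}} P" ..
  qed
  have "\<exists>P. P \<in> C \<and> card P + i = Suc n" if "i \<le> n" for i
    using that
  proof (induction i)
    case 0
    show ?case using bottom by (intro exI[of _ "(\<lambda>x. {x}) ` {0..n}"]) (simp add: card_image)
  next
    case (Suc i)
    then obtain P where P: "P \<in> C" "card P + i = Suc n" by auto
    \<comment> \<open>\<open>Q\<close> is to be the next member above \<open>P\<close>: among those
      with fewer blocks, one with the most. The one-block partition is a candidate, as
      \<open>Suc i \<le> n\<close> leaves \<open>P\<close> at least two blocks.\<close>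
    have "\<exists>Q. (Q \<in> C \<and> card Q < card P) \<and> (\<forall>R. R \<in> C \<and> card R < card P \<longrightarrow> card R \<le> card Q)"
      using top P Suc.prems by (intro ex_has_greatest_nat[of _ "{{0..n}}" _ "card P"]) auto
    then obtain Q where Q: "Q \<in> C" "card Q < card P"
      and Qmax: "\<And>R. R \<in> C \<Longrightarrow> card R < card P \<Longrightarrow> card R \<le> card Q" by blast
    have PQ: "refines {0..n} P Q" "P \<noteq> Q" using card_less[OF P(1) Q(1)] Q by auto
    obtain x y where step: "merge_step n P (merge_blocks P x y) x y"
      and M: "merge_blocks P x y \<in> NC n" "refines {0..n} (merge_blocks P x y) Q"
      using NC_interpolation[OF C_NC[OF P(1)] C_NC[OF Q(1)] PQ] .
    let ?M = "merge_blocks P x y"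
    have Pp: "partition_on {0..n} P" using C_NC[OF P(1)] by (rule NC_partition)
    have xy: "x \<in> {0..n}" "y \<in> {0..n}" "block_of P x \<noteq> block_of P y"
      using step by (auto simp: merge_step_def)
    have PM: "refines {0..n} P ?M" by (rule refines_merge_blocks[OF Pp xy(1,2)])
    have cM: "Suc (card ?M) = card P" by (rule card_merge_blocks[OF Pp xy(1,2) _ xy(3)]) simp
    have "?M \<in> C"
    proof (rule maximal[OF M(1)])
      fix R
      assume R: "R \<in> C"
      show "refines {0..n} R ?M \<or> refines {0..n} ?M R"
      proof (cases "card R < card P")
        case True
        then have "refines {0..n} Q R" using card_less[OF Q(1) R] Qmax[OF R] by blast
        then show ?thesis using M(2) refines_trans by blast
      next
        case False
        then have "refines {0..n} R P" using card_less[OF R P(1)] by simp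
        then show ?thesis using PM refines_trans by blast
      qed
    qed
    then show ?case using cM P(2) by (intro exI[of _ ?M]) simp
  qed
  then obtain \<pi> where \<pi>: "\<And>i. i \<le> n \<Longrightarrow> \<pi> i \<in> C \<and> card (\<pi> i) + i = Suc n" by metis
  have "saturated n \<pi>"
    unfolding saturated_def
  proof (intro conjI allI impI)
    fix i assume "i \<le> n"
    then show "\<pi> i \<in> NC n" "card (\<pi> i) + i = Suc n" using \<pi> C_NC by blast+
  next
    fix i j assume "i \<le> n" "j \<le> n" "i \<le> j"
    then show "refines {0..n} (\<pi> i) (\<pi> j)"
      using \<pi>[of i] \<pi>[of j] by (intro card_less) auto
  qed
  moreover have "C = \<pi> ` {0..n}"
  proof
    show "\<pi> ` {0..n} \<subseteq> C" using \<pi> by auto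
    show "C \<subseteq> \<pi> ` {0..n}"
    proof
      fix P
      assume P: "P \<in> C"
      define i where "i = Suc n - card P"
      have i: "i \<le> n" "card P + i = Suc n" using NC_card_bounds[OF C_NC[OF P]] by (auto simp: i_def)
      then have "P = \<pi> i" using \<pi>[OF i(1)] by (intro card_eq[OF P]) auto
      then show "P \<in> \<pi> ` {0..n}" using i by simp
    qed
  qed
  ultimately show thesis by (rule that)
qed

text \<open>The merge that fits in between refines \<open>\<pi> (Suc i)\<close> and has as many
  blocks, so the two are equal.\<close>

lemma saturated_merge_step:
  assumes sat: "saturated n \<pi>" and i: "i < n"
  shows "\<exists>x y. merge_step n (\<pi> i) (\<pi> (Suc i)) x y"
proof -
  have ne: "\<pi> i \<noteq> \<pi> (Suc i)" using saturated_inj[OF sat, of i "Suc i"] i by auto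
  obtain x y where step: "merge_step n (\<pi> i) (merge_blocks (\<pi> i) x y) x y"
    and ref: "refines {0..n} (merge_blocks (\<pi> i) x y) (\<pi> (Suc i))"
    using NC_interpolation[of "\<pi> i" n "\<pi> (Suc i)"] saturatedD(1,3)[OF sat] i ne
    by (metis Suc_leI le_SucI le_refl less_imp_le_nat)
  have P: "partition_on {0..n} (\<pi> i)" using saturatedD(1)[OF sat] i NC_partition by simp
  have "Suc (card (merge_blocks (\<pi> i) x y)) = card (\<pi> i)"
    using step by (intro card_merge_blocks[OF P]) (auto simp: merge_step_def)
  then have "card (merge_blocks (\<pi> i) x y) = card (\<pi> (Suc i))"
    using saturatedD(2)[OF sat, of i] saturatedD(2)[OF sat, of "Suc i"] i by simp
  then have "merge_blocks (\<pi> i) x y = \<pi> (Suc i)"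
    using refines_card_le(2)[OF _ ref] by simp
  then show ?thesis using step by metis
qed

lemma
  assumes sat: "saturated n \<pi>" and i: "i < n" and step: "merge_step n (\<pi> i) (\<pi> (Suc i)) x y"
  shows upper_merge_step: "upper n (\<pi> ` {0..n}) (Suc i) = x"
    and lower_merge_step: "lower n (\<pi> ` {0..n}) (Suc i) = y"
proof -
  have P: "partition_on {0..n} (\<pi> i)" using saturatedD(1)[OF sat] i NC_partition by simp
  have elem: "chain_elem n (\<pi> ` {0..n}) i = \<pi> i" "chain_elem n (\<pi> ` {0..n}) (Suc i) = \<pi> (Suc i)"
    using chain_elem_saturated[OF sat] i by auto
  show u: "upper n (\<pi> ` {0..n}) (Suc i) = x"
    unfolding upper_def using merge_step_upper[OF P step] by (simp add: elem)
  show "lower n (\<pi> ` {0..n}) (Suc i) = y"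
    unfolding lower_def u using merge_step_lower[OF P step] by (simp add: elem)
qed

section \<open>From trees to chains\<close>

text \<open>The labels \<open>x i\<close> of vertex \<open>i\<close> and \<open>l i\<close> of its parent: the edges of a labelled tree become
  arcs on the line \<open>{0..n}\<close>.\<close>

locale noncrossing_arcs =
  fixes n :: nat and x l :: "nat \<Rightarrow> nat"
  assumes inj_x: "inj_on x {1..n}"
    and x_le: "i \<in> {1..n} \<Longrightarrow> x i \<le> n"
    and l_less: "i \<in> {1..n} \<Longrightarrow> l i < x i"
    and siblings: "i \<in> {1..n} \<Longrightarrow> j \<in> {1..n} \<Longrightarrow> i < j \<Longrightarrow> l i = l j \<Longrightarrow> x j < x i"
    and no_crossing: "i \<in> {1..n} \<Longrightarrow> j \<in> {1..n} \<Longrightarrow> l i < l j \<Longrightarrow> l j < x i \<Longrightarrow> x i < x j \<Longrightarrow> False"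
begin

primrec arc_partition :: "nat \<Rightarrow> nat set set" where
  "arc_partition 0 = (\<lambda>z. {z}) ` {0..n}"
| "arc_partition (Suc i) = merge_blocks (arc_partition i) (x (Suc i)) (l (Suc i))"

text \<open>\<open>rep i z\<close> is the minimum of the block of \<open>z\<close> in the \<open>i\<close>-th partition.\<close>

primrec rep :: "nat \<Rightarrow> nat \<Rightarrow> nat" where
  "rep 0 z = z"
| "rep (Suc i) z = (if rep i z = x (Suc i) then rep i (l (Suc i)) else rep i z)"

section \<open>Block minima and blocks of the arc partitions\<close>

lemma rep_le: "i \<le> n \<Longrightarrow> rep i z \<le> z"
proof (induction i arbitrary: z)
  case (Suc i)
  have "rep i (l (Suc i)) \<le> l (Suc i)" "rep i z \<le> z" using Suc by simp_all
  then show ?case using l_less[of "Suc i"] Suc.prems by auto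
qed simp

lemma x_Suc_new: "i < n \<Longrightarrow> x (Suc i) \<notin> x ` {1..i}"
  using inj_on_image_mem_iff[OF inj_x, of "Suc i" "{1..i}"] by auto

text \<open>A label is the minimum of its block until the arc with this upper end is merged; by
  injectivity of \<open>x\<close> there is at most one such arc.\<close>

lemma rep_eq_self_iff: "i \<le> n \<Longrightarrow> rep i z = z \<longleftrightarrow> z \<notin> x ` {1..i}"
proof (induction i arbitrary: z)
  case (Suc i)
  have IH: "rep i z = z \<longleftrightarrow> z \<notin> x ` {1..i}" for z using Suc by simp
  have new: "x (Suc i) \<notin> x ` {1..i}"
    using x_Suc_new Suc.prems by simp
  have img: "x ` {1..Suc i} = insert (x (Suc i)) (x ` {1..i})"
    by (simp add: atLeastAtMostSuc_conv)
  show ?case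
  proof (cases "rep i z = x (Suc i)")
    case True
    have "rep i (l (Suc i)) \<le> l (Suc i)" "rep i z \<le> z" using rep_le Suc.prems by simp_all
    moreover have "l (Suc i) < x (Suc i)" using l_less Suc.prems by simp
    ultimately have "rep (Suc i) z \<noteq> z" using True by simp
    moreover have "z \<in> x ` {1..Suc i}"
      using IH[of z] True img by auto
    ultimately show ?thesis by simp
  next
    case False
    then have "z \<noteq> x (Suc i)" using IH[of z] new by auto
    then show ?thesis using False IH img by simp
  qed
qed simp

lemma rep_x_Suc: "i < n \<Longrightarrow> rep i (x (Suc i)) = x (Suc i)"
  using rep_eq_self_iff[of i "x (Suc i)"] x_Suc_new by simp

lemma
  assumes "i \<le> n"
  shows partition_on_arc_partition: "partition_on {0..n} (arc_partition i)"
    and block_of_arc_partition: "\<And>z. z \<in> {0..n} \<Longrightarrow>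
      block_of (arc_partition i) z = {w \<in> {0..n}. rep i w = rep i z}"
proof -
  have "partition_on {0..n} (arc_partition i) \<and>
      (\<forall>z\<in>{0..n}. block_of (arc_partition i) z = {w \<in> {0..n}. rep i w = rep i z})"
    using assms
  proof (induction i)
    case 0
    have part: "partition_on {0..n} (arc_partition 0)" by (simp add: partition_on_singletons)
    have "block_of (arc_partition 0) z = {z}" if "z \<in> {0..n}" for z
      using that by (intro block_of_eq[OF part]) auto
    then show ?case using part by auto
  next
    case (Suc i)
    then have part: "partition_on {0..n} (arc_partition i)"
      and block: "\<And>z. z \<in> {0..n} \<Longrightarrow> block_of (arc_partition i) z = {w \<in> {0..n}. rep i w = rep i z}"
      by simp_all
    have X: "x (Suc i) \<in> {0..n}" and L: "l (Suc i) \<in> {0..n}"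
      using x_le[of "Suc i"] l_less[of "Suc i"] Suc.prems by auto
    have rX: "rep i (x (Suc i)) = x (Suc i)" using rep_x_Suc Suc.prems by simp
    have block_eq: "block_of (arc_partition i) z = block_of (arc_partition i) w \<longleftrightarrow> rep i z = rep i w"
      if "z \<in> {0..n}" "w \<in> {0..n}" for z w
    proof -
      have "z \<in> block_of (arc_partition i) w \<longleftrightarrow> rep i z = rep i w"
        using block[OF that(2)] that by simp
      then show ?thesis using block_of_eq_iff[OF part that(2), of z] that by blast
    qed
    show ?case
    proof (intro conjI ballI)
      show "partition_on {0..n} (arc_partition (Suc i))"
        using partition_on_merge_blocks[OF part X L] by simp
      fix z
      assume z: "z \<in> {0..n}"
      have "block_of (arc_partition (Suc i)) z =
        (if rep i z = x (Suc i) \<or> rep i z = rep i (l (Suc i))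
         then {w \<in> {0..n}. rep i w = x (Suc i)} \<union> {w \<in> {0..n}. rep i w = rep i (l (Suc i))}
         else {w \<in> {0..n}. rep i w = rep i z})"
        unfolding arc_partition.simps block_of_merge_blocks[OF part X L z]
          block_eq[OF z X] block_eq[OF z L]
        unfolding block[OF z] block[OF X] block[OF L] rX ..
      \<comment> \<open>Redirecting the value \<open>x (Suc i)\<close> to the minimum of the other
        block unites two fibres of \<open>rep i\<close> into one of
        \<open>rep (Suc i)\<close>.\<close>
      also have "\<dots> = {w \<in> {0..n}. rep (Suc i) w = rep (Suc i) z}"
        by auto
      finally show "block_of (arc_partition (Suc i)) z = {w \<in> {0..n}. rep (Suc i) w = rep (Suc i) z}" .
    qed
  qed
  then show "partition_on {0..n} (arc_partition i)"
    "\<And>z. z \<in> {0..n} \<Longrightarrow> block_of (arc_partition i) z = {w \<in> {0..n}. rep i w = rep i z}"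
    by blast+
qed

text \<open>Following the arcs down from \<open>w\<close> to the minimum of its block, some arc jumps over \<open>b\<close>.\<close>

lemma arc_over:
  assumes "i \<le> n" "rep i w < b" "b \<le> w"
  shows "\<exists>j\<in>{1..i}. b \<le> x j \<and> x j \<le> w \<and> l j < b \<and> rep i (x j) = rep i w \<and> rep i (l j) = rep i w"
  using assms
proof (induction i arbitrary: w)
  case 0
  then show ?case by simp
next
  case (Suc i)
  \<comment> \<open>It suffices to start from some \<open>v\<close> at or below \<open>w\<close>, in
    the same new block, to which the previous stage applies.\<close>
  have lift: ?case if v: "rep i v < b" "b \<le> v" "v \<le> w" "rep (Suc i) v = rep (Suc i) w" for v
  proof -
    obtain j where j: "j \<in> {1..i}" "b \<le> x j" "x j \<le> v" "l j < b"
      "rep i (x j) = rep i v" "rep i (l j) = rep i v"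
      using Suc.IH[of v] Suc.prems v by auto
    then have "rep (Suc i) (x j) = rep (Suc i) v" "rep (Suc i) (l j) = rep (Suc i) v" by simp_all
    then show ?thesis using j v by (intro bexI[of _ j]) auto
  qed
  show ?case
  proof (cases "rep i w = x (Suc i)")
    case False
    then show ?thesis using lift[of w] Suc.prems by simp
  next
    case True
    have X: "x (Suc i) \<le> w" using rep_le[of i w] True Suc.prems by simp
    have rX: "rep i (x (Suc i)) = x (Suc i)" using rep_x_Suc Suc.prems by simp
    have lX: "l (Suc i) < x (Suc i)" using l_less Suc.prems by simp
    have rl: "rep i (l (Suc i)) \<le> l (Suc i)" using rep_le Suc.prems by simp
    have rw: "rep (Suc i) w = rep i (l (Suc i))" using True by simp
    have rl': "rep (Suc i) (l (Suc i)) = rep i (l (Suc i))" using rl lX by simp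
    \<comment> \<open>Position of \<open>b\<close> relative to the newest arc. Above its upper end,
      older arcs serve \<open>w\<close>; under the arc, the arc itself passes over \<open>b\<close>;
      at or below its lower end, continue from there.\<close>
    consider "x (Suc i) < b" | "b \<le> x (Suc i)" "l (Suc i) < b" | "b \<le> l (Suc i)" by linarith
    then show ?thesis
    proof cases
      case 1
      then show ?thesis using lift[of w] Suc.prems True by simp
    next
      case 2
      then show ?thesis using X rX rw rl' by (intro bexI[of _ "Suc i"]) auto
    next
      case 3
      then show ?thesis
        using lift[of "l (Suc i)"] Suc.prems rw rl' lX X by simp
    qed
  qed
qed

text \<open>Suppose \<open>a\<close>, \<open>c\<close> and \<open>b\<close>, \<open>d\<close>
  interleave. An arc \<open>j\<close> of the block of \<open>a\<close> passes over \<open>b\<close>,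
  and an arc \<open>k\<close> of the block of \<open>b\<close> passes over \<open>x j\<close>. As
  these do not cross, \<open>l k < l j\<close>. So the block of \<open>b\<close> reaches below
  \<open>l j\<close>, and an arc \<open>m\<close> of it passes over \<open>l j\<close> with upper
  end at most \<open>b\<close>: arcs \<open>m\<close> and \<open>j\<close> cross.\<close>

lemma arc_partition_NC:
  assumes i: "i \<le> n"
  shows "arc_partition i \<in> NC n"
proof -
  note part = partition_on_arc_partition[OF i]
  have in_n: "j \<in> {1..n}" if "j \<in> {1..i}" for j using that i by simp
  have "rep i a = rep i b"
    if lt: "a < b" "b < c" "c < d" and eq: "rep i c = rep i a" "rep i d = rep i b" for a b c d
  proof (rule ccontr)
    assume ne: "rep i a \<noteq> rep i b"
    have le: "rep i a \<le> a" "rep i b \<le> b" using rep_le[OF i] by auto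
    obtain j where j: "j \<in> {1..i}" "b \<le> x j" "x j \<le> c" "l j < b" "rep i (x j) = rep i a" "rep i (l j) = rep i a"
      using arc_over[OF i, of c b] le lt eq by auto
    \<comment> \<open>\<open>arc_over\<close> gives only \<open>b \<le> x j\<close>; equality would
      put one label into both blocks. The same upgrade is made for \<open>k\<close> and
      \<open>m\<close>.\<close>
    then have bj: "b < x j" using ne le_neq_implies_less by metis
    obtain k where k: "k \<in> {1..i}" "x j \<le> x k" "l k < x j" "rep i (x k) = rep i b" "rep i (l k) = rep i b"
      using arc_over[OF i, of d "x j"] le lt eq bj j by auto
    then have jk: "x j < x k" using ne j le_neq_implies_less by metis
    have "\<not> l j < l k" using no_crossing[OF in_n[OF j(1)] in_n[OF k(1)]] k jk by blast
    moreover have "l j \<noteq> l k" using j k ne by metis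
    ultimately have lk: "l k < l j" by simp
    then have "rep i b < l j" using rep_le[OF i, of "l k"] k by simp
    then obtain m where m: "m \<in> {1..i}" "l j \<le> x m" "x m \<le> b" "l m < l j" "rep i (x m) = rep i b"
      using arc_over[OF i, of b "l j"] j by auto
    then have "l j < x m" using ne j le_neq_implies_less by metis
    then show False using no_crossing[OF in_n[OF m(1)] in_n[OF j(1)]] m bj by simp
  qed
  note nc = this
  have block_eq: "block_of (arc_partition i) z = block_of (arc_partition i) w \<longleftrightarrow> rep i z = rep i w"
    if "z \<in> {0..n}" "w \<in> {0..n}" for z w
  proof -
    have "z \<in> block_of (arc_partition i) w \<longleftrightarrow> rep i z = rep i w"
      using block_of_arc_partition[OF i that(2)] that by simp
    then show ?thesis using block_of_eq_iff[OF part that(2), of z] that by blast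
  qed
  have "noncrossing (arc_partition i)"
    unfolding noncrossing_iff_block_of[OF part]
  proof (intro allI impI, elim conjE)
    fix a b c d
    assume "a < b" "b < c" "c < d" "d \<le> n" "block_of (arc_partition i) c = block_of (arc_partition i) a"
      "block_of (arc_partition i) d = block_of (arc_partition i) b"
    then show "block_of (arc_partition i) a = block_of (arc_partition i) b"
      using nc[of a b c d] block_eq by simp
  qed
  then show ?thesis using part by (simp add: NC_def)
qed

lemma arc_partition_merge_step:
  assumes i: "i < n"
  shows "merge_step n (arc_partition i) (arc_partition (Suc i)) (x (Suc i)) (l (Suc i))"
proof -
  let ?X = "x (Suc i)" and ?L = "l (Suc i)"
  have Si: "Suc i \<in> {1..n}" using i by simp
  have X: "?X \<in> {0..n}" and L: "?L \<in> {0..n}" and LX: "?L < ?X"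
    using x_le[OF Si] l_less[OF Si] by auto
  have i': "i \<le> n" "Suc i \<le> n" using i by auto
  have rX: "rep i ?X = ?X" using rep_x_Suc[OF i] .
  have rL: "rep i ?L \<le> ?L" using rep_le[OF i'(1)] .
  have "?X \<le> z" if "z \<in> block_of (arc_partition i) ?X" for z
    using that block_of_arc_partition[OF i'(1) X] rX rep_le[OF i'(1), of z] by simp
  moreover have "block_of (arc_partition i) ?X \<noteq> block_of (arc_partition i) ?L"
  proof -
    have "?X \<notin> block_of (arc_partition i) ?L"
      using block_of_arc_partition[OF i'(1) L] rX rL LX by simp
    then show ?thesis
      using block_of_in(2)[OF partition_on_arc_partition[OF i'(1)] X] by blast
  qed
  moreover have "z \<le> ?L" if z: "z \<in> block_of (arc_partition (Suc i)) ?X" "z < ?X" for z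
  proof (rule ccontr)
    assume "\<not> z \<le> ?L"
    have "rep (Suc i) z = rep (Suc i) ?X"
      using z(1) block_of_arc_partition[OF i'(2) X] by simp
    then have "rep (Suc i) z < Suc ?L" using rX rL by simp
    \<comment> \<open>With bound \<open>Suc ?L\<close>, the arc found starts at or before
      \<open>?L\<close> and ends strictly between \<open>?L\<close> and \<open>?X\<close>. Starting
      before \<open>?L\<close>, it crosses the newest arc; starting at \<open>?L\<close>, it is a
      sibling of smaller index, whose upper end would have to exceed \<open>?X\<close>.\<close>
    then obtain j where j: "j \<in> {1..Suc i}" "Suc ?L \<le> x j" "x j \<le> z" "l j < Suc ?L"
      using arc_over[OF i'(2), of z "Suc ?L"] \<open>\<not> z \<le> ?L\<close> by auto
    then have "j \<noteq> Suc i" using z(2) by auto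
    then have j': "j \<in> {1..n}" "j < Suc i" using j(1) i by auto
    have "l j \<noteq> ?L" using siblings[OF j'(1) Si j'(2)] j z(2) by auto
    then show False using no_crossing[OF j'(1) Si] j z(2) by simp
  qed
  ultimately show ?thesis
    unfolding merge_step_def using LX X by simp
qed

lemma arc_partition_saturated: "saturated n arc_partition"
proof -
  have card: "card (arc_partition i) + i = Suc n" if "i \<le> n" for i
    using that
  proof (induction i)
    case 0
    show ?case by (simp add: card_image)
  next
    case (Suc i)
    have step: "merge_step n (arc_partition i) (arc_partition (Suc i)) (x (Suc i)) (l (Suc i))"
      using arc_partition_merge_step Suc.prems by simp
    have "Suc (card (arc_partition (Suc i))) = card (arc_partition i)"
      unfolding arc_partition.simps using step Suc.prems
      by (intro card_merge_blocks[OF partition_on_arc_partition]) (auto simp: merge_step_def)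
    then show ?case using Suc by simp
  qed
  have "refines {0..n} (arc_partition i) (arc_partition j)" if "i \<le> j" "j \<le> n" for i j
    using that
  proof (induction j rule: dec_induct)
    case base
    then show ?case using partition_on_arc_partition by (simp add: refines_refl)
  next
    case (step j)
    have "x (Suc j) \<in> {0..n}" "l (Suc j) \<in> {0..n}"
      using x_le[of "Suc j"] l_less[of "Suc j"] step.prems by auto
    then have "refines {0..n} (arc_partition j) (arc_partition (Suc j))"
      unfolding arc_partition.simps using step.prems
      by (intro refines_merge_blocks partition_on_arc_partition) auto
    then show ?case using step refines_trans by (metis Suc_leD)
  qed
  then show ?thesis using card arc_partition_NC by (simp add: saturated_def)
qed

end

section \<open>The arcs of a labelled tree and the recovery of the tree\<close>

context
  fixes n :: nat and T :: "(nat option \<times> nat option) set"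
  assumes T: "functional_tree (cone_vertices n) None T"
begin

lemma parent_edge:
  assumes "i \<in> {1..n}"
  shows "(Some i, parent T i) \<in> T"
proof -
  have "(Some i, None) \<in> T\<^sup>*" using functional_treeD(5)[OF T] assms by simp
  then obtain v where "(Some i, v) \<in> T" by (auto elim: converse_rtranclE)
  then show ?thesis unfolding parent_def
    by (rule theI) (use \<open>(Some i, v) \<in> T\<close> functional_treeD(4)[OF T] in metis)
qed

lemma edges_eq_parent: "T = (\<lambda>i. (Some i, parent T i)) ` {1..n}"
proof
  show "(\<lambda>i. (Some i, parent T i)) ` {1..n} \<subseteq> T" using parent_edge by blast
  show "T \<subseteq> (\<lambda>i. (Some i, parent T i)) ` {1..n}"
  proof (rule subrelI)
    fix u v
    assume uv: "(u, v) \<in> T"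
    then obtain i where i: "u = Some i" "i \<in> {1..n}"
      using functional_treeD(1,2)[OF T uv] by auto
    then have "v = parent T i" using functional_treeD(4)[OF T] uv parent_edge by metis
    then show "(u, v) \<in> (\<lambda>i. (Some i, parent T i)) ` {1..n}" using i by blast
  qed
qed

text \<open>The vertex labelled 0 has no parent, since a parent would need a smaller label.
  \<open>chain_label\<close> gives the root 0 by definition, so the two agree there.\<close>

lemma tree_label_None: "tree_label n T None = 0"
proof -
  note p = is_tree_label_tree_label[OF T]
  have bij: "bij_betw (tree_label n T) (cone_vertices n) {0..n}"
    and down: "\<And>u v. (u, v) \<in> T \<Longrightarrow> tree_label n T v < tree_label n T u"
    using p by (auto simp: is_tree_label_def)
  have "0 \<in> tree_label n T ` cone_vertices n"
    using bij by (simp add: bij_betw_def del: image_insert)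
  then obtain v where v: "v \<in> cone_vertices n" "tree_label n T v = 0" by (metis imageE)
  have "v = None"
  proof (rule ccontr)
    assume "v \<noteq> None"
    then obtain i where "v = Some i" "i \<in> {1..n}" using v(1) by auto
    then show False using down[OF parent_edge] v(2) by fastforce
  qed
  then show ?thesis using v(2) by simp
qed

lemma noncrossing_arcs_tree_label:
  "noncrossing_arcs n (\<lambda>i. tree_label n T (Some i)) (\<lambda>i. tree_label n T (parent T i))"
proof -
  note p = is_tree_label_tree_label[OF T]
  have bij: "bij_betw (tree_label n T) (cone_vertices n) {0..n}"
    and down: "\<And>u v. (u, v) \<in> T \<Longrightarrow> tree_label n T v < tree_label n T u"
    and sib: "\<And>i j k. (Some i, k) \<in> T \<Longrightarrow> (Some j, k) \<in> T \<Longrightarrow> i < j \<Longrightarrow>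
      tree_label n T (Some j) < tree_label n T (Some i)"
    and cross: "\<And>u v u' v'. (u, v) \<in> T \<Longrightarrow> (u', v') \<in> T \<Longrightarrow> tree_label n T v < tree_label n T v' \<Longrightarrow>
      tree_label n T v' < tree_label n T u \<Longrightarrow> tree_label n T u < tree_label n T u' \<Longrightarrow> False"
    using p unfolding is_tree_label_def by blast+
  have inj: "inj_on (tree_label n T) (cone_vertices n)" using bij by (rule bij_betw_imp_inj_on)
  show ?thesis
  proof
    show "inj_on (\<lambda>i. tree_label n T (Some i)) {1..n}"
    proof (rule inj_onI)
      fix i j
      assume "i \<in> {1..n}" "j \<in> {1..n}" "tree_label n T (Some i) = tree_label n T (Some j)"
      then show "i = j" using inj_onD[OF inj, of "Some i" "Some j"] by simp
    qed
    show "tree_label n T (Some i) \<le> n" if "i \<in> {1..n}" for i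
      using bij_betwE[OF bij] that by auto
    show "tree_label n T (parent T i) < tree_label n T (Some i)" if "i \<in> {1..n}" for i
      using down[OF parent_edge[OF that]] .
    show "tree_label n T (Some j) < tree_label n T (Some i)"
      if ij: "i \<in> {1..n}" "j \<in> {1..n}" "i < j"
        and eq: "tree_label n T (parent T i) = tree_label n T (parent T j)" for i j
    proof -
      have "parent T i = parent T j"
        using inj_onD[OF inj eq] functional_treeD(3)[OF T] parent_edge ij by metis
      then show ?thesis using sib parent_edge ij by metis
    qed
    show False if "i \<in> {1..n}" "j \<in> {1..n}" "tree_label n T (parent T i) < tree_label n T (parent T j)"
      "tree_label n T (parent T j) < tree_label n T (Some i)"
      "tree_label n T (Some i) < tree_label n T (Some j)" for i j
      using cross[OF parent_edge[OF that(1)] parent_edge[OF that(2)]] that by blast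
  qed
qed

text \<open>The tree partitions are the arc partitions of the labelled tree, so \<open>upper\<close>
  and \<open>lower\<close> return the labels of a vertex and its parent. Then
  \<open>chain_label\<close> equals \<open>tree_label\<close> on the vertices, and inverting it
  returns the edges.\<close>

lemma
  shows chain_of_tree_in_max_chains: "chain_of_tree n T \<in> max_chains n"
    and tree_of_chain_of_tree: "tree_of_chain n (chain_of_tree n T) = T"
proof -
  interpret noncrossing_arcs n "\<lambda>i. tree_label n T (Some i)" "\<lambda>i. tree_label n T (parent T i)"
    by (rule noncrossing_arcs_tree_label)
  have "tree_partition n T i = arc_partition i" for i
    by (induction i) simp_all
  then have C: "chain_of_tree n T = arc_partition ` {0..n}"
    by (simp add: chain_of_tree_def)
  show "chain_of_tree n T \<in> max_chains n"
    unfolding C by (rule saturated_in_max_chains[OF arc_partition_saturated])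
  have up: "upper n (chain_of_tree n T) i = tree_label n T (Some i)"
    and low: "lower n (chain_of_tree n T) i = tree_label n T (parent T i)" if i: "i \<in> {1..n}" for i
  proof -
    obtain k where k: "i = Suc k" "k < n" using i by (cases i) auto
    show "upper n (chain_of_tree n T) i = tree_label n T (Some i)"
      "lower n (chain_of_tree n T) i = tree_label n T (parent T i)"
      unfolding C k(1)
      by (rule upper_merge_step[OF arc_partition_saturated k(2) arc_partition_merge_step[OF k(2)]]
          lower_merge_step[OF arc_partition_saturated k(2) arc_partition_merge_step[OF k(2)]])+
  qed
  have label: "chain_label n (chain_of_tree n T) v = tree_label n T v" if "v \<in> cone_vertices n" for v
    using that by (cases v) (auto simp: chain_label_def tree_label_None up)
  have inj: "inj_on (chain_label n (chain_of_tree n T)) (cone_vertices n)"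
  proof -
    have "inj_on (tree_label n T) (cone_vertices n)"
      using is_tree_label_tree_label[OF T] by (simp add: is_tree_label_def bij_betw_def)
    then show ?thesis using label inj_on_cong by metis
  qed
  have inv: "inv_into (cone_vertices n) (chain_label n (chain_of_tree n T)) (tree_label n T v) = v"
    if "v \<in> cone_vertices n" for v
    using inv_into_f_f[OF inj that] label[OF that] by simp
  have "tree_of_chain n (chain_of_tree n T) = (\<lambda>i. (Some i, parent T i)) ` {1..n}"
    unfolding tree_of_chain_def
  proof (rule image_cong[OF refl])
    fix i
    assume i: "i \<in> {1..n}"
    have "Some i \<in> cone_vertices n" "parent T i \<in> cone_vertices n"
      using functional_treeD(1,3)[OF T parent_edge[OF i]] .
    then show "(inv_into (cone_vertices n) (chain_label n (chain_of_tree n T)) (upper n (chain_of_tree n T) i),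
        inv_into (cone_vertices n) (chain_label n (chain_of_tree n T)) (lower n (chain_of_tree n T) i))
      = (Some i, parent T i)"
      unfolding up[OF i] low[OF i] using inv by simp
  qed
  then show "tree_of_chain n (chain_of_tree n T) = T" using edges_eq_parent by simp
qed

end

section \<open>From chains to trees\<close>

context
  fixes n :: nat and \<pi> :: "nat \<Rightarrow> nat set set" and x l :: "nat \<Rightarrow> nat"
  assumes sat: "saturated n \<pi>"
    and step: "\<And>i. i < n \<Longrightarrow> merge_step n (\<pi> i) (\<pi> (Suc i)) (x (Suc i)) (l (Suc i))"
begin

lemma saturated_partition: "i \<le> n \<Longrightarrow> partition_on {0..n} (\<pi> i)"
  using saturatedD(1)[OF sat] NC_partition by blast

lemma merge_step_facts:
  assumes i: "i \<in> {1..n}"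
  shows "l i < x i" "x i \<in> {0..n}" "l i \<in> {0..n}"
    "\<And>z. z \<in> block_of (\<pi> (i - 1)) (x i) \<Longrightarrow> x i \<le> z"
    "\<And>z. z \<in> block_of (\<pi> i) (x i) \<Longrightarrow> z < x i \<Longrightarrow> z \<le> l i"
    "\<pi> i = merge_blocks (\<pi> (i - 1)) (x i) (l i)"
proof -
  obtain k where "i = Suc k" "k < n" using i by (cases i) auto
  then show "l i < x i" "x i \<in> {0..n}" "l i \<in> {0..n}"
    "\<And>z. z \<in> block_of (\<pi> (i - 1)) (x i) \<Longrightarrow> x i \<le> z"
    "\<And>z. z \<in> block_of (\<pi> i) (x i) \<Longrightarrow> z < x i \<Longrightarrow> z \<le> l i"
    "\<pi> i = merge_blocks (\<pi> (i - 1)) (x i) (l i)"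
    using step[of k] by (auto simp: merge_step_def)
qed

lemma merged_afterwards:
  assumes i: "i \<in> {1..n}" and j: "i \<le> j" "j \<le> n"
  shows "block_of (\<pi> j) (l i) = block_of (\<pi> j) (x i)"
proof -
  have P: "partition_on {0..n} (\<pi> (i - 1))" using saturated_partition i by auto
  note f = merge_step_facts[OF i]
  have "block_of (\<pi> i) (x i) = block_of (\<pi> (i - 1)) (x i) \<union> block_of (\<pi> (i - 1)) (l i)"
    using block_of_merge_blocks[OF P f(2,3) f(2)] f(6) by simp
  then have "l i \<in> block_of (\<pi> i) (x i)" using block_of_in(2)[OF P f(3)] by simp
  then have "l i \<in> block_of (\<pi> j) (x i)"
    using refines_block_of[OF saturatedD(3)[OF sat j] f(2)] by blast
  then show ?thesis using block_of_eq_iff[OF saturated_partition[OF j(2)] f(2)] by blast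
qed

lemma same_block_below:
  assumes i: "i \<in> {1..n}" and z: "z \<in> {0..n}" "block_of (\<pi> i) z = block_of (\<pi> i) (x i)" "z < x i"
  shows "z \<le> l i"
proof -
  have "i \<le> n" using i by simp
  from block_of_eq_iff[OF saturated_partition[OF this] merge_step_facts(2)[OF i], of z] z
  show ?thesis using merge_step_facts(5)[OF i] by blast
qed

text \<open>After step \<open>i\<close> the label \<open>x i\<close> has \<open>l i\<close> below it
  in its block, so it is never again a minimum and cannot be a later \<open>x j\<close>. For
  siblings with \<open>x i < x j\<close>, at step \<open>j\<close> the element \<open>x i\<close> of
  the common block would lie strictly between \<open>l j\<close> and \<open>x j\<close>.\<close>

lemma saturated_noncrossing_arcs: "noncrossing_arcs n x l"
proof
  have neq: "x i \<noteq> x j" if ij: "i \<in> {1..n}" "j \<in> {1..n}" "i < j" for i j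
  proof
    assume eq: "x i = x j"
    have "block_of (\<pi> (j - 1)) (l i) = block_of (\<pi> (j - 1)) (x i)"
      using merged_afterwards[of i "j - 1"] ij by auto
    moreover have "partition_on {0..n} (\<pi> (j - 1))" using saturated_partition ij by auto
    ultimately have "l i \<in> block_of (\<pi> (j - 1)) (x j)"
      using block_of_in(2)[of _ _ "l i"] merge_step_facts(3)[OF ij(1)] eq by metis
    then show False
      using merge_step_facts(4)[OF ij(2)] merge_step_facts(1)[OF ij(1)] eq by fastforce
  qed
  show "inj_on x {1..n}"
    using neq by (metis inj_onI linorder_neqE_nat)
  show "x i \<le> n" "l i < x i" if "i \<in> {1..n}" for i
    using merge_step_facts(1,2)[OF that] by auto
  show "x j < x i" if ij: "i \<in> {1..n}" "j \<in> {1..n}" "i < j" and eq: "l i = l j" for i j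
  proof (rule ccontr)
    assume "\<not> x j < x i"
    then have lt: "x i < x j" using neq[OF ij] by simp
    have "block_of (\<pi> j) (l i) = block_of (\<pi> j) (x i)"
      using merged_afterwards[OF ij(1), of j] ij by simp
    moreover have "block_of (\<pi> j) (l j) = block_of (\<pi> j) (x j)"
      using merged_afterwards[OF ij(2), of j] ij by simp
    ultimately have "x i \<le> l j"
      using same_block_below[OF ij(2) merge_step_facts(2)[OF ij(1)] _ lt] eq by simp
    then show False using merge_step_facts(1)[OF ij(1)] eq by simp
  qed
  show False if ij: "i \<in> {1..n}" "j \<in> {1..n}" and lt: "l i < l j" "l j < x i" "x i < x j" for i j
  proof -
    \<comment> \<open>At the later step each arc has both ends in one block, and noncrossing unites
      these blocks. The later arc then has an end of the other strictly between its own: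
      \<open>x i\<close> if it is \<open>j\<close>, \<open>l j\<close> if it is
      \<open>i\<close>.\<close>
    define k where "k = max i j"
    have k: "i \<le> k" "j \<le> k" "k \<le> n" using ij by (auto simp: k_def)
    have i: "block_of (\<pi> k) (l i) = block_of (\<pi> k) (x i)" and j: "block_of (\<pi> k) (l j) = block_of (\<pi> k) (x j)"
      using merged_afterwards ij k by auto
    have "block_of (\<pi> k) (l i) = block_of (\<pi> k) (l j)"
      using NC_noncrossing[OF saturatedD(1)[OF sat k(3)] lt] merge_step_facts(2)[OF ij(2)] i j by simp
    then have eq: "block_of (\<pi> k) (x i) = block_of (\<pi> k) (x j)" "block_of (\<pi> k) (l j) = block_of (\<pi> k) (x i)"
      using i j by simp_all
    show False
    proof (cases "i \<le> j")
      case True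
      then have "x i \<le> l j"
        using same_block_below[OF ij(2) merge_step_facts(2)[OF ij(1)] _ lt(3)] eq(1) by (simp add: k_def)
      then show False using lt by simp
    next
      case False
      then have "l j \<le> l i"
        using same_block_below[OF ij(1) merge_step_facts(3)[OF ij(2)] _ lt(2)] eq(2) by (simp add: k_def)
      then show False using lt by simp
    qed
  qed
qed

lemma saturated_0: "\<pi> 0 = (\<lambda>z. {z}) ` {0..n}"
proof -
  have P: "partition_on {0..n} (\<pi> 0)" by (rule saturated_partition) simp
  have "refines {0..n} ((\<lambda>z. {z}) ` {0..n}) (\<pi> 0)"
    unfolding refines_def using P partition_on_singletons partition_onD1[OF P] by auto
  moreover have "card ((\<lambda>z. {z}) ` {0..n}) = card (\<pi> 0)"
    using saturatedD(2)[OF sat, of 0] by (simp add: card_image)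
  ultimately show ?thesis using refines_card_le(2) by (metis finite_atLeastAtMost)
qed

end

text \<open>The labels read off from the chain satisfy \<open>is_tree_label\<close> for the tree
  built from them. Uniqueness identifies them with \<open>tree_label\<close>, so the tree repeats
  the merges of the chain.\<close>

lemma
  assumes C: "C \<in> max_chains n"
  shows functional_tree_tree_of_chain: "functional_tree (cone_vertices n) None (tree_of_chain n C)"
    and chain_of_tree_of_chain: "chain_of_tree n (tree_of_chain n C) = C"
proof -
  obtain \<pi> where sat: "saturated n \<pi>" and C_eq: "C = \<pi> ` {0..n}"
    using max_chain_saturated[OF C] .
  define x where "x = upper n C"
  define l where "l = lower n C"
  have step: "merge_step n (\<pi> i) (\<pi> (Suc i)) (x (Suc i)) (l (Suc i))" if i: "i < n" for i
  proof -
    obtain a b where ab: "merge_step n (\<pi> i) (\<pi> (Suc i)) a b"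
      using saturated_merge_step[OF sat i] by blast
    then show ?thesis
      using upper_merge_step[OF sat i ab] lower_merge_step[OF sat i ab] by (simp add: x_def l_def C_eq)
  qed
  interpret noncrossing_arcs n x l
    by (rule saturated_noncrossing_arcs[OF sat step])
  have \<pi>_eq: "\<pi> i = arc_partition i" if "i \<le> n" for i
    using that
  proof (induction i)
    case 0
    show ?case using saturated_0[OF sat step] by simp
  next
    case (Suc i)
    then show ?case using step[of i] by (simp add: merge_step_def)
  qed
  define V where "V = cone_vertices n"
  \<comment> \<open>Restricted because \<open>is_tree_label\<close> asks for an extensional
    function.\<close>
  define p where "p = restrict (chain_label n C) V"
  define T where "T = tree_of_chain n C"
  have p_simps: "p None = 0" "\<And>i. i \<in> {1..n} \<Longrightarrow> p (Some i) = x i"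
    by (auto simp: p_def V_def chain_label_def x_def)
  have inj: "inj_on p V"
  proof (rule inj_onI)
    fix u v
    assume uv: "u \<in> V" "v \<in> V" "p u = p v"
    \<comment> \<open>An upper element lies above its lower one, so none takes the value 0 of the
      root.\<close>
    have pos: "0 < p (Some i)" if "i \<in> {1..n}" for i
      using l_less[OF that] p_simps(2)[OF that] by simp
    show "u = v"
    proof (cases u)
      case None
      then show ?thesis using uv pos[of "the v"] p_simps(1) by (cases v) (auto simp: V_def)
    next
      case u: (Some i)
      show ?thesis
      proof (cases v)
        case None
        then show ?thesis using uv u pos[of i] p_simps(1) by (auto simp: V_def)
      next
        case (Some j)
        have "i \<in> {1..n}" "j \<in> {1..n}" using uv(1,2) u Some by (auto simp: V_def)
        then show ?thesis using inj_onD[OF inj_x, of i j] uv(3) p_simps(2) u Some by simp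
      qed
    qed
  qed
  have img: "p ` V = {0..n}"
  proof (rule card_subset_eq)
    show "p ` V \<subseteq> {0..n}" using p_simps x_le by (auto simp: V_def)
    show "card (p ` V) = card {0..n}"
      using card_image[OF inj] card_cone_vertices[of n] by (simp add: V_def)
  qed simp
  have bij: "bij_betw p V {0..n}" using inj img by (rule bij_betw_imageI)
  define q where "q i = inv_into V p (l i)" for i
  have l_range: "l i \<in> p ` V" if "i \<in> {1..n}" for i
    using l_less[OF that] x_le[OF that] img by simp
  have q: "q i \<in> V" "p (q i) = l i" if "i \<in> {1..n}" for i
    using inv_into_into[OF l_range[OF that]] f_inv_into_f[OF l_range[OF that]] by (auto simp: q_def)
  have label_p: "chain_label n C v = p v" if "v \<in> V" for v using that by (simp add: p_def)
  have inj_label: "inj_on (chain_label n C) V" using inj by (simp add: p_def)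
  have inv: "inv_into V (chain_label n C) (p v) = v" if "v \<in> V" for v
    using inv_into_f_f[OF inj_label that] label_p[OF that] by simp
  have T_eq: "T = (\<lambda>i. (Some i, q i)) ` {1..n}"
    unfolding T_def tree_of_chain_def
  proof (rule image_cong[OF refl])
    fix i
    assume i: "i \<in> {1..n}"
    then have "Some i \<in> V" by (simp add: V_def)
    then have "inv_into V (chain_label n C) (x i) = Some i"
      using inv[of "Some i"] p_simps(2)[OF i] by simp
    moreover have "inv_into V (chain_label n C) (l i) = q i"
      using inv[OF q(1)[OF i]] q(2)[OF i] by simp
    ultimately show "(inv_into (cone_vertices n) (chain_label n C) (upper n C i),
        inv_into (cone_vertices n) (chain_label n C) (lower n C i)) = (Some i, q i)"
      by (simp only: V_def x_def l_def)
  qed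
  have T_iff: "(u, v) \<in> T \<longleftrightarrow> (\<exists>i\<in>{1..n}. u = Some i \<and> v = q i)" for u v
    unfolding T_eq by auto
  \<comment> \<open>Labels drop from \<open>x i\<close> to \<open>l i\<close> along each edge, so
    following parents ends at the root.\<close>
  have reach: "(v, None) \<in> T\<^sup>*" if "v \<in> V" for v
    using that
  proof (induction "p v" arbitrary: v rule: less_induct)
    case less
    show ?case
    proof (cases v)
      case (Some i)
      then have i: "i \<in> {1..n}" using less.prems by (auto simp: V_def)
      have "(q i, None) \<in> T\<^sup>*"
        using less.hyps[of "q i"] q[OF i] l_less[OF i] p_simps(2)[OF i] Some by simp
      moreover have "(v, q i) \<in> T" using T_iff i Some by blast
      ultimately show ?thesis by (rule converse_rtrancl_into_rtrancl[rotated])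
    qed simp
  qed
  have tree: "functional_tree V None T"
    unfolding functional_tree_def
  proof (intro conjI ballI reach)
    have "Some i \<in> V" if "i \<in> {1..n}" for i using that by (simp add: V_def)
    then show "T \<subseteq> (V - {None}) \<times> V" unfolding T_eq using q(1) by blast
    show "single_valued T" by (auto simp: single_valued_def T_iff)
  qed
  then show "functional_tree (cone_vertices n) None (tree_of_chain n C)"
    by (simp only: T_def V_def)
  have edge: "\<exists>i\<in>{1..n}. u = Some i \<and> p u = x i \<and> p v = l i" if "(u, v) \<in> T" for u v
    using that T_iff p_simps(2) q(2) by auto
  have "is_tree_label n T p"
    unfolding is_tree_label_def V_def[symmetric]
  proof (intro conjI allI impI notI)
    show "p \<in> extensional V" by (simp add: p_def)
    show "bij_betw p V {0..n}" by (rule bij)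
    show "p v < p u" if "(u, v) \<in> T" for u v using edge[OF that] l_less by auto
    show "p (Some j) < p (Some i)" if "(Some i, k) \<in> T \<and> (Some j, k) \<in> T \<and> i < j" for i j k
      using edge[of "Some i" k] edge[of "Some j" k] that siblings[of i j] by auto
    show False if ex: "\<exists>u v u' v'. (u, v) \<in> T \<and> (u', v') \<in> T \<and> p v < p v' \<and> p v' < p u \<and> p u < p u'"
    proof -
      obtain u v u' v' where *: "(u, v) \<in> T" "(u', v') \<in> T" "p v < p v'" "p v' < p u" "p u < p u'"
        using ex by blast
      obtain i j where "i \<in> {1..n}" "p u = x i" "p v = l i" "j \<in> {1..n}" "p u' = x j" "p v' = l j"
        using edge[OF *(1)] edge[OF *(2)] by blast
      then show False using no_crossing[of i j] * by simp
    qed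
  qed
  then have label: "tree_label n T = p"
    using tree_label_eqI tree by (simp add: V_def)
  have parent: "parent T i = q i" if "i \<in> {1..n}" for i
    unfolding parent_def using that by (intro the_equality) (auto simp: T_iff)
  have "tree_partition n T i = \<pi> i" if "i \<le> n" for i
    using that
  proof (induction i)
    case 0
    show ?case using \<pi>_eq[of 0] by simp
  next
    case (Suc i)
    then have "Suc i \<in> {1..n}" by simp
    then show ?case
      using Suc \<pi>_eq[of i] \<pi>_eq[of "Suc i"] label parent p_simps(2) q(2) by simp
  qed
  then have "tree_partition n T ` {0..n} = \<pi> ` {0..n}" by simp
  then show "chain_of_tree n (tree_of_chain n C) = C"
    by (simp add: chain_of_tree_def T_def C_eq)
qed

theorem theorem4p22:
  fixes n :: nat
  shows "cone (complete_graph {1..n}) = complete_graph (insert None (Some ` {1..n})) \<and>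
    (\<forall>T \<in> root_trees n. tree_of_chain n (chain_of_tree n T) = T) \<and>
    (\<forall>C \<in> max_chains n. chain_of_tree n (tree_of_chain n C) = C) \<and>
    bij_betw (chain_of_tree n) (root_trees n) (max_chains n) \<and>
    bij_betw (tree_of_chain n) (max_chains n) (root_trees n) \<and>
    bij_betw delete_root (root_trees n) (rooted_spanning_forests (complete_graph {1..n}))"
proof -
  have trees: "root_trees n = {T. functional_tree (cone_vertices n) None T}"
    unfolding cone_complete_graph by (rule rooted_spanning_trees_complete_graph) simp
  have TC: "tree_of_chain n (chain_of_tree n T) = T" "chain_of_tree n T \<in> max_chains n"
    if "T \<in> root_trees n" for T
    using tree_of_chain_of_tree chain_of_tree_in_max_chains that unfolding trees by auto
  have CT: "chain_of_tree n (tree_of_chain n C) = C" "tree_of_chain n C \<in> root_trees n"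
    if "C \<in> max_chains n" for C
    using chain_of_tree_of_chain functional_tree_tree_of_chain that unfolding trees by auto
  have "bij_betw (chain_of_tree n) (root_trees n) (max_chains n)"
    by (rule bij_betw_byWitness[where f' = "tree_of_chain n"]) (use TC CT in auto)
  moreover have "bij_betw (tree_of_chain n) (max_chains n) (root_trees n)"
    by (rule bij_betw_byWitness[where f' = "chain_of_tree n"]) (use TC CT in auto)
  moreover have "bij_betw delete_root (root_trees n) (rooted_spanning_forests (complete_graph {1..n}))"
    unfolding trees by (rule bij_betw_delete_root)
  ultimately show ?thesis using cone_complete_graph TC(1) CT(1) by blast
qed

end
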